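(* For each integer $n\ge1$, let $\delta_n$ be the only positive root of $$\Phi_{n,0}(x)=x^{n+1}+x^n+x^{n-1}+\cdots+x^2-1,$$ and let $\zeta_n=\delta_n^{\frac12}+\delta_n^{-\frac12}$. Then $2=\zeta_1<\zeta_2<\cdots$, $\lim_{n\to\infty}\zeta_n=\sqrt{2+\sqrt5}$, and the numbers $\zeta_n$ ($n\geq 1$) are precisely the limit points of the $A$-spectral radius of graphs that are smaller than $\sqrt{2+\sqrt5}$.
   Context: Graphs are finite, simple and undirected. For a graph $G$ with adjacency matrix $A(G)$, the $A$-spectral radius $\rho_A(G)$ is the largest absolute value of an eigenvalue of $A(G)$. A real number $\gamma$ is a limit point of the $A$-spectral radius of graphs if there is a sequence of graphs $(G_k)_{k\in\mathbb N}$ with $\rho_A(G_i)\ne\rho_A(G_j)$ whenever $i\ne j$ and $\lim_{k\to\infty}\rho_A(G_k)=\gamma$. For $n=1$ the polynomial is $\Phi_{1,0}(x)=x^2-1$. *)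

theory Defs
  imports
    "Graph_Theory.Pair_Digraph"
    "Jordan_Normal_Form.Spectral_Radius"
begin

text \<open>
  A finite simple undirected graph is a \<^locale>\<open>pair_graph\<close> (finite, symmetric, loop-free; its
  arcs are pairs of vertices, so there are no multiple edges) with at least one vertex. The null
  graph has an empty spectrum, hence no spectral radius.
\<close>

definition simple_graph :: "'a pair_pre_digraph \<Rightarrow> bool" where
  "simple_graph G \<longleftrightarrow> pair_graph G \<and> pverts G \<noteq> {}"

text \<open>
  Rows and columns are indexed by the vertices in increasing order; any other enumeration gives a
  permutation-similar matrix. The entries are complex because \<^const>\<open>spectral_radius\<close> (the maximal
  modulus of an eigenvalue) is defined for complex matrices; as the matrix is real symmetric,
  its complex eigenvalues are exactly its real ones.
\<close>

definition adjacency_matrix :: "'a::linorder pair_pre_digraph \<Rightarrow> complex mat" where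
  "adjacency_matrix G =
    (let vs = sorted_list_of_set (pverts G); n = card (pverts G)
     in mat n n (\<lambda>(i, j). if (vs ! i, vs ! j) \<in> parcs G then 1 else 0))"

definition rho_A :: "'a::linorder pair_pre_digraph \<Rightarrow> real" where
  "rho_A G = spectral_radius (adjacency_matrix G)"

text \<open>
  Taking the vertices to be natural numbers is no restriction, since every finite graph is
  isomorphic to one of these.
\<close>

definition limit_point_rho_A :: "real \<Rightarrow> bool" where
  "limit_point_rho_A \<gamma> \<longleftrightarrow>
    (\<exists>G :: nat \<Rightarrow> nat pair_pre_digraph.
       (\<forall>k. simple_graph (G k)) \<and>
       (\<forall>i j. i \<noteq> j \<longrightarrow> rho_A (G i) \<noteq> rho_A (G j)) \<and>
       (\<lambda>k. rho_A (G k)) \<longlonglongrightarrow> \<gamma>)"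

definition Phi :: "nat \<Rightarrow> real poly" where
  "Phi n = (\<Sum>k = 2..n + 1. monom 1 k) - 1"

definition delta :: "nat \<Rightarrow> real" where
  "delta n = (THE x. 0 < x \<and> poly (Phi n) x = 0)"

definition zeta :: "nat \<Rightarrow> real" where
  "zeta n = delta n powr (1 / 2) + delta n powr (- (1 / 2))"

end

theory Submission
  imports Defs "HOL-Analysis.Convex"
begin

text \<open>
  The spectral radius \<open>\<rho>\<close> of a graph has an eigenvector \<open>y\<close> that is positive on a union of components,
  and all information about \<open>\<rho>\<close> is extracted from the ratios \<open>y w / y v\<close> along the edges. Write
  \<open>\<rho> = t + 1 / t\<close> with \<open>t \<ge> 1\<close>. Leaving a vertex along a pendant path of \<open>n\<close> vertices forces the ratio
  \<open>arm n \<rho>\<close>, a rational function of \<open>\<rho>\<close> increasing to \<open>1 / t\<close> with \<open>n\<close>; leaving it along a path that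
  meets another vertex of degree at least 3 forces a ratio of at least \<open>1 / t\<close>.

  For \<open>2 < \<rho> < \<surd>(2 + \<surd>5)\<close> the ratios around a vertex, which sum to \<open>\<rho>\<close>, then leave only two
  possibilities: one vertex of degree 3 (a star with three arms), or two such vertices, each with a
  pendant edge and a further arm. In both cases the lengths of the paths determine \<open>\<rho>\<close>, so along a
  sequence of distinct spectral radii some length tends to infinity. In the limit this yields
  \<open>\<rho> = 1 / \<rho> + arm n \<rho> + 1 / t\<close> for some \<open>n\<close>, which in terms of \<open>x = 1 / t\<^sup>2\<close> is \<open>\<Phi>\<^sub>n x = 0\<close>.
  Spectral radii at most \<open>2 - \<epsilon>\<close> come from components of bounded size, hence there are only finitely
  many of them. Conversely, \<open>\<zeta>\<^sub>1 = 2\<close> is approached by paths and \<open>\<zeta>\<^sub>n\<close> by stars with arms of \<open>1\<close>, \<open>n\<close> and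
  \<open>k \<rightarrow> \<infinity>\<close> vertices.
\<close>

section \<open>The roots of the polynomials\<close>

lemma poly_Phi: "poly (Phi n) x = x\<^sup>2 * (\<Sum>i<n. x ^ i) - 1"
proof -
  have "(\<Sum>k = 2..n + 1. x ^ k) = (\<Sum>i<n. x ^ (i + 2))"
    by (rule sum.reindex_bij_witness[of _ "\<lambda>i. i + 2" "\<lambda>k. k - 2"]) (auto simp flip: power_Suc simp: Suc_diff_Suc numeral_2_eq_2)
  also have "\<dots> = x\<^sup>2 * (\<Sum>i<n. x ^ i)"
    by (simp add: sum_distrib_left power2_eq_square mult_ac)
  finally show ?thesis unfolding Phi_def by (simp add: poly_sum poly_monom del: sum.cl_ivl_Suc)
qed

text \<open>In the factored form of \<open>poly_Phi\<close> the square increases strictly and the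
  geometric sum does not decrease; for n >= 1 its term i = 0 keeps it at least 1, so strictness
  survives.\<close>

lemma Phi_strict_mono:
  assumes "n \<ge> 1" "0 \<le> x" "x < y"
  shows "poly (Phi n) x < poly (Phi n) y"
proof -
  have 1: "1 \<le> (\<Sum>i<n. y ^ i)"
    using assms member_le_sum[of 0 "{..<n}" "\<lambda>i. y ^ i"] by simp
  have "x\<^sup>2 * (\<Sum>i<n. x ^ i) \<le> x\<^sup>2 * (\<Sum>i<n. y ^ i)"
    using assms by (intro mult_left_mono sum_mono power_mono) auto
  also have "\<dots> < y\<^sup>2 * (\<Sum>i<n. y ^ i)"
    using assms 1 by (intro mult_strict_right_mono power_strict_mono) auto
  finally show ?thesis by (simp add: poly_Phi)
qed

lemma Phi_root_exists:
  assumes "n \<ge> 1"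
  shows "\<exists>x>0. x \<le> 1 \<and> poly (Phi n) x = 0"
proof -
  have "\<exists>x\<ge>0. x \<le> 1 \<and> poly (Phi n) x = 0"
    using assms by (intro IVT) (auto simp: poly_Phi)
  then obtain x where x: "x \<ge> 0" "x \<le> 1" "poly (Phi n) x = 0" by blast
  moreover have "x \<noteq> 0" using x(3) by (auto simp: poly_Phi)
  ultimately show ?thesis by (intro exI[of _ x]) auto
qed

lemma Phi_root_unique:
  assumes "n \<ge> 1" "0 < x" "0 < y" "poly (Phi n) x = 0" "poly (Phi n) y = 0"
  shows "x = y"
  using Phi_strict_mono[of n x y] Phi_strict_mono[of n y x] assms by (cases x y rule: linorder_cases) auto

lemma Phi_root_ex1: "n \<ge> 1 \<Longrightarrow> \<exists>!x. 0 < x \<and> poly (Phi n) x = 0"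
  using Phi_root_exists[of n] Phi_root_unique[of n] by blast

lemma delta_root:
  assumes "n \<ge> 1"
  shows "0 < delta n" "delta n \<le> 1" "poly (Phi n) (delta n) = 0"
proof -
  show 1: "0 < delta n" and 2: "poly (Phi n) (delta n) = 0"
    using theI'[OF Phi_root_ex1[OF assms]] by (auto simp: delta_def)
  show "delta n \<le> 1"
    using Phi_root_exists[OF assms] Phi_root_unique[OF assms 1 _ 2] by metis
qed

lemma delta_eqI: "n \<ge> 1 \<Longrightarrow> 0 < x \<Longrightarrow> poly (Phi n) x = 0 \<Longrightarrow> delta n = x"
  using delta_root[of n] Phi_root_unique[of n] by blast

lemma zeta_eq:
  assumes "n \<ge> 1"
  shows "zeta n = 1 / sqrt (delta n) + sqrt (delta n)"
proof -
  have "delta n powr (1 / 2) = sqrt (delta n)"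
    using delta_root(1)[OF assms] by (intro powr_half_sqrt) simp
  then show ?thesis unfolding zeta_def powr_minus_divide by simp
qed

text \<open>The difference of the two sides is (t - s)(s t - 1) / (s t).\<close>

lemma add_inverse_strict_mono:
  fixes s t :: real
  assumes "1 \<le> s" "s < t"
  shows "s + 1 / s < t + 1 / t"
proof -
  have "0 < (t - s) * (s * t - 1)"
    using assms less_le_trans[of 1 t "s * t"] by (intro mult_pos_pos) auto
  then show ?thesis using assms by (simp add: field_simps)
qed

text \<open>Going from n to n + 1 adds the term x^(n + 2), so the next polynomial is already
  positive at \<open>delta n\<close>.\<close>

lemma delta_strict_decreasing:
  assumes "n \<ge> 1"
  shows "delta (n + 1) < delta n"
proof (rule ccontr)
  assume "\<not> ?thesis"
  then have le: "delta n \<le> delta (n + 1)" by simp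
  note d = delta_root[OF assms]
  have "0 < poly (Phi (n + 1)) (delta n)"
    using d by (simp add: poly_Phi distrib_left)
  also have "\<dots> \<le> poly (Phi (n + 1)) (delta (n + 1))"
    using le d Phi_strict_mono[of "n + 1" "delta n" "delta (n + 1)"] by (cases "delta n = delta (n + 1)") auto
  also have "\<dots> = 0" by (rule delta_root) simp
  finally show False by simp
qed

lemma zeta_strict_increasing:
  assumes "n \<ge> 1"
  shows "zeta n < zeta (n + 1)"
proof -
  note d = delta_root[OF assms] delta_root[of "n + 1"] delta_strict_decreasing[OF assms]
  have "1 / sqrt (delta n) + 1 / (1 / sqrt (delta n)) < 1 / sqrt (delta (n + 1)) + 1 / (1 / sqrt (delta (n + 1)))"
    using d by (intro add_inverse_strict_mono) (auto simp: field_simps)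
  then show ?thesis using assms by (simp add: zeta_eq)
qed

lemma zeta_1: "zeta 1 = 2"
proof -
  have "delta 1 = 1" by (rule delta_eqI) (auto simp: poly_Phi)
  then show ?thesis by (simp add: zeta_def)
qed

section \<open>The limit of the roots \<open>delta n\<close>, the reciprocal of the golden
  ratio\<close>

definition golden :: real where
  "golden = (sqrt 5 - 1) / 2"

lemma golden: "0 < golden" "golden < 1" "golden\<^sup>2 + golden = 1"
  "1 / golden + golden = sqrt 5"
proof -
  have s: "sqrt 5 * sqrt 5 = (5::real)" by simp
  have s2: "2 < sqrt (5::real)" by (rule real_less_rsqrt) simp
  have s3: "sqrt (5::real) < 3" by (rule real_less_lsqrt) simp_all
  show g0: "0 < golden" and "golden < 1" using s2 s3 by (auto simp: golden_def)
  show g: "golden\<^sup>2 + golden = 1"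
    using s by (simp add: golden_def power2_eq_square field_simps)
  have "golden * (1 + golden) = 1" using g by (simp add: power2_eq_square algebra_simps)
  then have "1 / golden = 1 + golden" using g0 by (simp add: field_simps)
  then show "1 / golden + golden = sqrt 5" by (simp add: golden_def)
qed

text \<open>For 0 < x < 1 the sign is that of x^2 + x - 1 up to a term that vanishes as n grows,
  which is why the roots converge to \<open>golden\<close>.\<close>

lemma Phi_sign_geometric:
  assumes "x \<noteq> (1::real)"
  shows "poly (Phi n) x = (x\<^sup>2 + x - 1 - x ^ (n + 2)) / (1 - x)"
proof -
  have "(\<Sum>i<n. x ^ i) = (1 - x ^ n) / (1 - x)" using assms by (simp add: sum_gp_strict)
  then have "poly (Phi n) x = (x\<^sup>2 * (1 - x ^ n) - (1 - x)) / (1 - x)"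
    using assms by (simp add: poly_Phi diff_divide_distrib[of _ "1 - x"])
  then show ?thesis by (simp add: power_add algebra_simps power2_eq_square)
qed

lemma golden_less_delta:
  assumes "n \<ge> 1"
  shows "golden < delta n"
proof (rule ccontr)
  assume "\<not> ?thesis"
  then have le: "delta n \<le> golden" by simp
  have "poly (Phi n) (delta n) \<le> poly (Phi n) golden"
    using le delta_root[OF assms] Phi_strict_mono[OF assms, of "delta n" golden] by (cases "delta n = golden") auto
  also have "\<dots> = - (golden ^ (n + 2)) / (1 - golden)"
    using golden by (simp add: Phi_sign_geometric)
  also have "\<dots> < 0" using golden by (simp add: divide_neg_pos)
  finally show False using delta_root[OF assms] by simp
qed

lemma Phi_eventually_pos:
  assumes "golden < x" "x < 1"
  shows "\<forall>\<^sub>F n in sequentially. poly (Phi n) x > 0"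
proof -
  \<comment> \<open>By \<open>golden(3)\<close> the product equals x^2 + x - 1, whose second root is
    -(1 + golden).\<close>
  have "0 < (x - golden) * (x + golden + 1)" using assms golden by (intro mult_pos_pos) auto
  then have pos: "0 < x\<^sup>2 + x - 1" using golden(3) by (simp add: power2_eq_square algebra_simps)
  have "(\<lambda>n. x ^ (n + 2)) \<longlonglongrightarrow> 0"
    using assms golden by (intro LIMSEQ_ignore_initial_segment LIMSEQ_realpow_zero) auto
  then have "\<forall>\<^sub>F n in sequentially. x ^ (n + 2) < x\<^sup>2 + x - 1"
    by (rule order_tendstoD(2)) (rule pos)
  then show ?thesis by eventually_elim (use assms in \<open>simp add: Phi_sign_geometric\<close>)
qed

lemma delta_tendsto: "delta \<longlonglongrightarrow> golden"
proof (rule order_tendstoI)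
  fix a assume "a < golden"
  then show "\<forall>\<^sub>F n in sequentially. a < delta n"
    by (intro eventually_sequentiallyI[of 1] less_trans[OF _ golden_less_delta])
next
  fix a assume a: "golden < a"
  \<comment> \<open>The cap at the midpoint of \<open>golden\<close> and 1 provides x < 1, which
    \<open>Phi_eventually_pos\<close> requires.\<close>
  define x where "x = min a ((golden + 1) / 2)"
  have x: "golden < x" "x < 1" "x \<le> a" using a golden(1,2) by (auto simp: x_def min_less_iff_disj)
  show "\<forall>\<^sub>F n in sequentially. delta n < a"
    using Phi_eventually_pos[OF x(1,2)] eventually_ge_at_top[of 1]
  proof eventually_elim
    case (elim n)
    then have "\<not> x \<le> delta n"
      using Phi_strict_mono[of n x "delta n"] delta_root[of n] x golden by (cases "x = delta n") auto
    then show ?case using x by simp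
  qed
qed

lemma sqrt_golden: "1 / sqrt golden + sqrt golden = sqrt (2 + sqrt 5)"
proof (rule real_sqrt_unique[symmetric])
  have "(1 / sqrt golden + sqrt golden)\<^sup>2 = 1 / golden + golden + 2"
    using golden by (simp add: power2_sum power_divide)
  then show "(1 / sqrt golden + sqrt golden)\<^sup>2 = 2 + sqrt 5" using golden by simp
  show "0 \<le> 1 / sqrt golden + sqrt golden" using golden by simp
qed

lemma zeta_tendsto: "zeta \<longlonglongrightarrow> sqrt (2 + sqrt 5)"
proof -
  have "(\<lambda>n. 1 / sqrt (delta n) + sqrt (delta n)) \<longlonglongrightarrow> 1 / sqrt golden + sqrt golden"
    using golden by (intro tendsto_intros delta_tendsto) auto
  moreover have "\<forall>\<^sub>F n in sequentially. 1 / sqrt (delta n) + sqrt (delta n) = zeta n"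
    using eventually_ge_at_top[of 1] by eventually_elim (simp add: zeta_eq)
  ultimately show ?thesis unfolding sqrt_golden by (rule Lim_transform_eventually)
qed

lemma zeta_less: "n \<ge> 1 \<Longrightarrow> zeta n < sqrt (2 + sqrt 5)"
proof -
  assume n: "n \<ge> 1"
  have "1 / sqrt (delta n) + 1 / (1 / sqrt (delta n)) < 1 / sqrt golden + 1 / (1 / sqrt golden)"
    using golden_less_delta[OF n] golden delta_root[OF n]
    by (intro add_inverse_strict_mono) (auto simp: field_simps)
  then show ?thesis using n sqrt_golden by (simp add: zeta_eq)
qed

section \<open>Pendant paths\<close>

text \<open>If \<open>y > 0\<close> satisfies the eigenvalue equation on a pendant path \<open>u, v\<^sub>1, \<dots>, v\<^sub>n\<close> ending in a
  leaf \<open>v\<^sub>n\<close>, then \<open>y v\<^sub>1 / y u = arm n \<rho>\<close>.\<close>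

primrec arm :: "nat \<Rightarrow> real \<Rightarrow> real" where
  "arm 0 \<rho> = 0"
| "arm (Suc n) \<rho> = 1 / (\<rho> - arm n \<rho>)"

lemma arm_bounds:
  assumes "\<rho> > 2"
  shows "0 \<le> arm n \<rho>" "arm n \<rho> < 1"
proof -
  have "0 \<le> arm n \<rho> \<and> arm n \<rho> < 1"
  proof (induction n)
    case (Suc n)
    then have "1 < \<rho> - arm n \<rho>" using assms by linarith
    then show ?case by simp
  qed simp
  then show "0 \<le> arm n \<rho>" "arm n \<rho> < 1" by auto
qed

lemma arm_less_Suc:
  assumes "\<rho> > 2"
  shows "arm n \<rho> < arm (Suc n) \<rho>"
proof (induction n)
  case 0
  then show ?case using assms by simp
next
  case (Suc n)
  then show ?case using arm_bounds[OF assms, of n] arm_bounds[OF assms, of "Suc n"] assms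
    unfolding arm.simps(2)[of "Suc n"] arm.simps(2)[of n, of \<rho>]
    by (intro divide_strict_left_mono mult_pos_pos) (auto simp del: arm.simps(2) simp flip: arm.simps(2))
qed

lemma arm_mono_index: "\<rho> > 2 \<Longrightarrow> m \<le> n \<Longrightarrow> arm m \<rho> \<le> arm n \<rho>"
  using lift_Suc_mono_le[of "\<lambda>n. arm n \<rho>"] arm_less_Suc less_imp_le by blast

lemma arm_antimono:
  assumes "2 < \<rho>" "\<rho> \<le> \<rho>'"
  shows "arm n \<rho>' \<le> arm n \<rho>"
proof (induction n)
  case (Suc n)
  have "arm n \<rho> < 1" using assms by (intro arm_bounds)
  then show ?case using Suc assms by (auto intro!: divide_left_mono mult_pos_pos)
qed simp

lemma tendsto_arm:
  assumes "(r \<longlongrightarrow> \<gamma>) F" "\<gamma> > 2"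
  shows "((\<lambda>k. arm n (r k)) \<longlongrightarrow> arm n \<gamma>) F"
proof (induction n)
  case (Suc n)
  have "\<gamma> - arm n \<gamma> \<noteq> 0" using assms(2) arm_bounds[OF assms(2), of n] by linarith
  then show ?case unfolding arm.simps using Suc assms by (intro tendsto_intros) auto
qed simp

section \<open>The substitution \<rho> = t + 1 / t, with \<open>growth \<rho>\<close> as the larger
  solution t\<close>

definition growth :: "real \<Rightarrow> real" where
  "growth \<rho> = (\<rho> + sqrt (\<rho>\<^sup>2 - 4)) / 2"

lemma growth:
  assumes "\<rho> > 2"
  shows "growth \<rho> > 1" "growth \<rho> + 1 / growth \<rho> = \<rho>"
proof -
  have "4 < \<rho>\<^sup>2" using power_strict_mono[of 2 \<rho> 2] assms by simp
  then have s: "sqrt (\<rho>\<^sup>2 - 4) > 0" "(sqrt (\<rho>\<^sup>2 - 4))\<^sup>2 = \<rho>\<^sup>2 - 4" by auto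
  show g: "growth \<rho> > 1" unfolding growth_def using add_strict_mono[OF assms s(1)] by simp
  have "growth \<rho> * (\<rho> - growth \<rho>) = 1"
    using s by (simp add: growth_def field_simps power2_eq_square)
  then have "1 / growth \<rho> = \<rho> - growth \<rho>" using g by (simp add: field_simps)
  then show "growth \<rho> + 1 / growth \<rho> = \<rho>" by simp
qed

lemma growth_add_inverse:
  assumes "t > 1"
  shows "growth (t + 1 / t) = t" "t + 1 / t > 2"
proof -
  have "1 + 1 / 1 < t + 1 / t" using assms by (intro add_inverse_strict_mono) auto
  then show g2: "t + 1 / t > 2" by simp
  note g = growth[OF g2]
  show "growth (t + 1 / t) = t"
    using add_inverse_strict_mono[of t "growth (t + 1 / t)"] add_inverse_strict_mono[of "growth (t + 1 / t)" t]
      g assms by (cases t "growth (t + 1 / t)" rule: linorder_cases) auto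
qed

lemma growth_mono:
  assumes "2 < \<rho>" "\<rho> \<le> \<rho>'"
  shows "growth \<rho> \<le> growth \<rho>'"
proof -
  have "\<rho>\<^sup>2 \<le> \<rho>'\<^sup>2" using assms by (intro power_mono) auto
  then have "sqrt (\<rho>\<^sup>2 - 4) \<le> sqrt (\<rho>'\<^sup>2 - 4)" by simp
  then show ?thesis unfolding growth_def using add_mono[OF assms(2)] by (intro divide_right_mono) auto
qed

lemma tendsto_growth: "(r \<longlongrightarrow> \<gamma>) F \<Longrightarrow> ((\<lambda>k. growth (r k)) \<longlongrightarrow> growth \<gamma>) F"
  unfolding growth_def by (intro tendsto_intros) auto

text \<open>Below sqrt (2 + sqrt 5) the square t^2 stays below the golden ratio g = 1 / golden, so
  t^2 (t^2 - 1) stays below g (g - 1) = 1. The quartic inequality drives \<open>two_arms_2\<close>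
  and \<open>fork_at_branch_vertex\<close>.\<close>

lemma growth_bound_golden:
  assumes "\<rho> > 2" "\<rho> < sqrt (2 + sqrt 5)"
  shows "growth \<rho> ^ 4 < growth \<rho> ^ 2 + 1" "golden < 1 / (growth \<rho>)\<^sup>2" "\<rho>\<^sup>2 < 2 + sqrt 5"
proof -
  define t where "t = growth \<rho>"
  note t = growth[OF assms(1), folded t_def]
  show "\<rho>\<^sup>2 < 2 + sqrt 5" using assms by (metis real_less_rsqrt real_sqrt_less_iff real_sqrt_abs abs_of_pos less_trans zero_less_numeral real_sqrt_power)
  have t': "t < 1 / sqrt golden"
  proof (rule ccontr)
    assume "\<not> ?thesis"
    then consider "t = 1 / sqrt golden" | "1 / sqrt golden < t" by linarith
    then have "1 / sqrt golden + 1 / (1 / sqrt golden) \<le> t + 1 / t"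
    proof cases
      case 2
      then show ?thesis using add_inverse_strict_mono[of "1 / sqrt golden" t] golden by simp
    qed simp
    then show False using assms t sqrt_golden by simp
  qed
  have "t\<^sup>2 < (1 / sqrt golden)\<^sup>2" using t t' by (intro power_strict_mono) auto
  then have t2: "t\<^sup>2 < 1 / golden" using golden by (simp add: power_divide)
  then show "golden < 1 / (growth \<rho>)\<^sup>2" using t golden unfolding t_def[symmetric] by (simp add: field_simps)
  have "golden * (1 + golden) = 1" using golden by (simp add: power2_eq_square algebra_simps)
  then have g1: "1 / golden = 1 + golden" using golden by (simp add: field_simps)
  have "t\<^sup>2 * (t\<^sup>2 - 1) < 1 / golden * (1 / golden - 1)" using t t2 golden
    by (intro mult_strict_mono) (auto simp: one_less_power less_imp_le)
  also have "1 / golden - 1 = golden" using g1 by simp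
  also have "1 / golden * golden = 1" using golden by simp
  finally show "growth \<rho> ^ 4 < growth \<rho> ^ 2 + 1" unfolding t_def[symmetric]
    by (simp add: algebra_simps flip: power_add)
qed

text \<open>1 / t is a fixed point of the increasing map x -> 1 / (\<rho> - x), since \<rho> - 1 / t
  = t; the iteration starts at 0, below it.\<close>

lemma arm_less_inverse_growth:
  assumes "\<rho> > 2"
  shows "arm n \<rho> < 1 / growth \<rho>"
proof (induction n)
  case (Suc n)
  have "growth \<rho> < \<rho> - arm n \<rho>" using Suc growth[OF assms] by linarith
  then show ?case using growth[OF assms] by (simp add: frac_less2)
qed (use growth[OF assms] in simp)

text \<open>One step divides the distance to the fixed point 1 / t by d t, where d = \<rho> -
  \<open>arm n \<rho>\<close> > t > 1; the bound keeps only the factor 1 / t.\<close>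

lemma arm_gap:
  assumes "\<rho> > 2"
  shows "1 / growth \<rho> - arm n \<rho> \<le> 1 / growth \<rho> ^ n"
proof (induction n)
  case (Suc n)
  define t where "t = growth \<rho>"
  note t = growth[OF assms, folded t_def]
  define d where "d = \<rho> - arm n \<rho>"
  have d: "t < d" using arm_less_inverse_growth[OF assms, of n] t unfolding d_def t_def[symmetric] by linarith
  have "1 / t - arm (Suc n) \<rho> = (d - t) / d / t" using d t by (simp add: d_def[symmetric] field_simps)
  also have "d - t = 1 / t - arm n \<rho>" using t by (simp add: d_def)
  also have "(1 / t - arm n \<rho>) / d / t \<le> (1 / t - arm n \<rho>) / t"
  proof (intro divide_right_mono)
    have "(1 / t - arm n \<rho>) * 1 \<le> (1 / t - arm n \<rho>) * d"
      using d t arm_less_inverse_growth[OF assms, of n, folded t_def] by (intro mult_left_mono) auto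
    then show "(1 / t - arm n \<rho>) / d \<le> 1 / t - arm n \<rho>" using d t by (simp add: pos_divide_le_eq)
  qed (use t in simp)
  also have "\<dots> \<le> 1 / t ^ n / t" using Suc t by (intro divide_right_mono) (auto simp: t_def)
  finally show ?case by (simp add: t_def mult_ac)
qed (use growth[OF assms] in simp)

lemma arm_2:
  assumes "\<rho> > 2"
  shows "arm 2 \<rho> = \<rho> / (\<rho>\<^sup>2 - 1)"
proof -
  have "4 < \<rho>\<^sup>2" using power_strict_mono[of 2 \<rho> 2] assms by simp
  then show ?thesis using assms by (simp add: numeral_2_eq_2 field_simps power2_eq_square)
qed

text \<open>\<open>margin n \<rho>\<close> = 0 is the equation at a vertex with a pendant edge, an
  arm of n vertices and an infinite arm: the three ratios are subtracted from \<rho>, with 1 / t as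
  the limit of \<open>arm k \<rho>\<close>.\<close>

definition margin :: "nat \<Rightarrow> real \<Rightarrow> real" where
  "margin n \<rho> = \<rho> - 1 / \<rho> - arm n \<rho> - 1 / growth \<rho>"

lemma tendsto_margin:
  assumes "(r \<longlongrightarrow> \<gamma>) F" "\<gamma> > 2"
  shows "((\<lambda>k. margin n (r k)) \<longlongrightarrow> margin n \<gamma>) F"
  unfolding margin_def using assms growth[OF assms(2)]
  by (intro tendsto_intros tendsto_arm tendsto_growth) auto

section \<open>The limiting equation in terms of x = 1 / t^2\<close>

lemma arm_eq_quotient:
  assumes "t > 1"
  defines "x \<equiv> 1 / t\<^sup>2"
  shows "arm n (t + 1 / t) = (\<Sum>i<n. x ^ i) / (t * (\<Sum>i<Suc n. x ^ i))"
proof (induction n)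
  case (Suc n)
  define S where "S = (\<lambda>n. \<Sum>i<n. x ^ i)"
  have x0: "x > 0" using assms by (simp add: x_def)
  have S1: "S (Suc n) > 0" for n unfolding S_def by (intro sum_pos) (use x0 in auto)
  \<comment> \<open>This recurrence matches the recursion of \<open>arm\<close> after cancelling t,
    because \<rho> = t (1 + x).\<close>
  have S2: "S (Suc (Suc n)) = (1 + x) * S (Suc n) - x * S n"
    by (simp add: S_def algebra_simps)
  have tx: "1 / t = t * x" using assms by (simp add: x_def power2_eq_square)
  have "t + 1 / t - S n / (t * S (Suc n)) = t * ((1 + x) * S (Suc n) - x * S n) / S (Suc n)"
    using S1[of n] tx assms(1) by (simp add: field_simps) (simp add: x_def power2_eq_square field_simps)
  also have "\<dots> = t * S (Suc (Suc n)) / S (Suc n)" by (simp only: S2)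
  finally have eq: "t + 1 / t - S n / (t * S (Suc n)) = t * S (Suc (Suc n)) / S (Suc n)" .
  have "arm (Suc n) (t + 1 / t) = 1 / (t + 1 / t - S n / (t * S (Suc n)))"
    unfolding arm.simps Suc.IH S_def ..
  also have "\<dots> = S (Suc n) / (t * S (Suc (Suc n)))" unfolding eq by simp
  finally show ?case by (simp only: S_def)
qed simp

text \<open>With S the sum of x^i over i < n, S' = 1 + x S and P = x (1 + x), the closed form of
  \<open>arm\<close> turns t times the margin into 1 / P - S / S' = (S' - P S) / (P S'), and the
  numerator collapses to 1 - x^2 S.\<close>

lemma margin_Phi:
  assumes "t > 1"
  shows "\<exists>c>0. margin n (t + 1 / t) = - c * poly (Phi n) (1 / t\<^sup>2)"
proof -
  define x where "x = 1 / t\<^sup>2"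
  have x0: "x > 0" using assms by (simp add: x_def)
  define S where "S = (\<Sum>i<n. x ^ i)"
  define S' where "S' = (\<Sum>i<Suc n. x ^ i)"
  have S': "S' > 0" unfolding S'_def by (intro sum_pos) (use x0 in auto)
  have rel: "S' = 1 + x * S" 
    unfolding S_def S'_def by (subst sum.lessThan_Suc_shift) (simp add: sum_distrib_left)
  have tx: "t\<^sup>2 = 1 / x" by (simp add: x_def)
  define P where "P = x * (1 + x)"
  have P: "P > 0" using x0 by (simp add: P_def)
  have "t\<^sup>2 + 1 > 0" by (simp add: add_nonneg_pos)
  then have r: "1 / (t + 1 / t) = t / (t\<^sup>2 + 1)" using assms by (simp add: field_simps power2_eq_square)
  have "t * margin n (t + 1 / t) = t\<^sup>2 - t\<^sup>2 / (t\<^sup>2 + 1) - S / S'"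
    unfolding margin_def r growth_add_inverse(1)[OF assms] arm_eq_quotient[OF assms, of n, folded x_def, folded S_def S'_def]
    using assms by (simp add: right_diff_distrib distrib_left power2_eq_square)
  also have "\<dots> = 1 / x - 1 / (1 + x) - S / S'" using x0 unfolding tx by (simp add: field_simps)
  also have "1 / x - 1 / (1 + x) = 1 / P" using x0 by (simp add: P_def field_simps)
  also have "1 / P - S / S' = (S' - P * S) / (P * S')"
    using P S' by (simp add: field_simps)
  also have "S' - P * S = - poly (Phi n) x"
    unfolding rel P_def by (simp add: poly_Phi S_def[symmetric] power2_eq_square algebra_simps)
  finally have "margin n (t + 1 / t) = - poly (Phi n) x / (P * S') / t"
    using assms by (subst eq_divide_eq) (simp add: mult.commute)
  then have "margin n (t + 1 / t) = - (1 / (t * (P * S'))) * poly (Phi n) x" by simp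
  moreover have "1 / (t * (P * S')) > 0" using assms P S' by simp
  ultimately show ?thesis unfolding x_def by blast
qed

lemma margin_sign:
  assumes "\<rho> > 2"
  shows "margin n \<rho> = 0 \<longleftrightarrow> poly (Phi n) (1 / (growth \<rho>)\<^sup>2) = 0"
    "margin n \<rho> < 0 \<longleftrightarrow> poly (Phi n) (1 / (growth \<rho>)\<^sup>2) > 0"
  using margin_Phi[of "growth \<rho>" n] growth[OF assms] by (auto simp: mult_less_0_iff zero_less_mult_iff)

lemma zeta_eqI:
  assumes "n \<ge> 1" "\<gamma> > 2" "margin n \<gamma> = 0"
  shows "\<gamma> = zeta n"
proof -
  note g = growth[OF assms(2)]
  have "delta n = 1 / (growth \<gamma>)\<^sup>2"
    using assms g margin_sign(1)[OF assms(2)] by (intro delta_eqI) auto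
  then show ?thesis using assms g by (simp add: zeta_eq real_sqrt_divide)
qed

lemma margin_antimono_index: "\<rho> > 2 \<Longrightarrow> m \<le> n \<Longrightarrow> margin n \<rho> \<le> margin m \<rho>"
  using arm_mono_index[of \<rho> m n] by (simp add: margin_def)

text \<open>1 / t^2 lies strictly between \<open>golden\<close> and 1, where the polynomials are
  eventually positive, and a positive polynomial means a negative margin.\<close>

lemma margin_eventually_neg:
  assumes "\<gamma> > 2" "\<gamma> < sqrt (2 + sqrt 5)"
  obtains K where "margin K \<gamma> < 0"
proof -
  have "1 < (growth \<gamma>)\<^sup>2" using growth[OF assms(1)] by (simp add: one_less_power)
  then have "\<forall>\<^sub>F n in sequentially. poly (Phi n) (1 / (growth \<gamma>)\<^sup>2) > 0"
    using growth_bound_golden(2)[OF assms] by (intro Phi_eventually_pos) (auto simp: divide_less_eq_1)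
  then obtain K where "poly (Phi K) (1 / (growth \<gamma>)\<^sup>2) > 0"
    by (auto simp: eventually_sequentially)
  then show ?thesis using margin_sign(2)[OF assms(1)] that by blast
qed

section \<open>Limits of the eigenvalue equations\<close>

lemma arm_1: "arm 1 \<rho> = 1 / \<rho>"
  by simp

text \<open>The ratio that the eigenvalue equation leaves for the third edge of a vertex of degree 3
  whose other two edges lead to a leaf and to an arm of n vertices.\<close>

definition branch :: "nat \<Rightarrow> real \<Rightarrow> real" where
  "branch n \<rho> = \<rho> - 1 / \<rho> - arm n \<rho>"

lemma margin_branch: "branch n \<rho> = 1 / growth \<rho> + margin n \<rho>"
  by (simp add: branch_def margin_def)

text \<open>The eigenvalue equation of a tree with one vertex of degree 3 and arms of \<open>a\<close>, \<open>b\<close>, \<open>c\<close>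
  vertices.\<close>

definition star_eq :: "real \<Rightarrow> nat \<Rightarrow> nat \<Rightarrow> nat \<Rightarrow> bool" where
  "star_eq \<rho> a b c \<longleftrightarrow> 1 \<le> a \<and> a \<le> b \<and> b \<le> c \<and> \<rho> = arm a \<rho> + arm b \<rho> + arm c \<rho>"

text \<open>The eigenvalue equation of a tree with two vertices of degree 3, joined by a path of length
  \<open>m + 1\<close>, each carrying a pendant edge and a further arm of \<open>a\<close> respectively \<open>b\<close> vertices: the
  ratio of consecutive values of the eigenvector is propagated along the path by \<open>q \<mapsto> \<rho> - 1 / q\<close>.\<close>

definition double_star_eq :: "real \<Rightarrow> nat \<Rightarrow> nat \<Rightarrow> nat \<Rightarrow> bool" where
  "double_star_eq \<rho> a b m \<longleftrightarrow> 1 \<le> a \<and> 1 \<le> b \<and> 0 \<le> margin a \<rho> \<and> 0 \<le> margin b \<rho> \<and>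
    ((\<lambda>q. \<rho> - 1 / q) ^^ m) (branch a \<rho>) * branch b \<rho> = 1"

text \<open>For fixed lengths the left side of the equation grows with \<rho>, while no arm on the
  right does.\<close>

lemma star_eq_unique:
  assumes "star_eq \<rho> a b c" "star_eq \<rho>' a b c" "2 < \<rho>" "2 < \<rho>'"
  shows "\<rho> = \<rho>'"
proof -
  have "\<not> \<rho> < \<rho>'" if "star_eq \<rho> a b c" "star_eq \<rho>' a b c" "2 < \<rho>" for \<rho> \<rho>'
  proof
    assume "\<rho> < \<rho>'"
    then have "arm n \<rho>' \<le> arm n \<rho>" for n using that by (intro arm_antimono) auto
    from this[of a] this[of b] this[of c] show False
      using that \<open>\<rho> < \<rho>'\<close> unfolding star_eq_def by linarith
  qed
  from this[of \<rho> \<rho>'] this[of \<rho>' \<rho>] show ?thesis using assms by auto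
qed

lemma branch_strict_mono:
  assumes "2 < \<rho>" "\<rho> < \<rho>'"
  shows "branch n \<rho> < branch n \<rho>'"
proof -
  have "1 / \<rho>' \<le> 1 / \<rho>" using assms by (simp add: frac_le)
  moreover have "arm n \<rho>' \<le> arm n \<rho>" using assms by (intro arm_antimono) auto
  ultimately show ?thesis using assms by (simp add: branch_def)
qed

text \<open>1 / t is fixed by the increasing map q -> \<rho> - 1 / q, so orbits that start at or
  above it stay there, and in particular stay positive.\<close>

lemma iterate_ge:
  assumes "2 < \<rho>" "1 / growth \<rho> \<le> q"
  shows "1 / growth \<rho> \<le> ((\<lambda>q. \<rho> - 1 / q) ^^ m) q"
proof (induction m)
  case (Suc m)
  note g = growth[OF assms(1)]
  define q' where "q' = ((\<lambda>q. \<rho> - 1 / q) ^^ m) q"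
  have "0 < 1 / growth \<rho>" using g by simp
  then have "1 / q' \<le> 1 / (1 / growth \<rho>)"
    using Suc by (intro divide_left_mono mult_pos_pos) (auto simp only: q'_def)
  then show ?case using g by (simp add: q'_def)
qed (use assms in simp)

text \<open>Both \<open>branch\<close> and the propagated ratio increase strictly with \<rho> as
  long as the ratios are positive, which \<open>iterate_ge\<close> guarantees; so their product
  equals 1 at most once.\<close>

lemma double_star_eq_unique:
  assumes "double_star_eq \<rho> a b m" "double_star_eq \<rho>' a b m" "2 < \<rho>" "2 < \<rho>'"
  shows "\<rho> = \<rho>'"
proof -
  have "\<not> \<rho> < \<rho>'" if *: "double_star_eq \<rho> a b m" "double_star_eq \<rho>' a b m" "2 < \<rho>" for \<rho> \<rho>'
  proof
    assume lt: "\<rho> < \<rho>'"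
    define q where "q = (\<lambda>\<rho> i. ((\<lambda>q. \<rho> - 1 / q) ^^ i) (branch a \<rho>))"
    have pos: "0 < 1 / growth \<rho>" using growth[OF *(3)] by simp
    have "1 / growth \<rho> \<le> branch a \<rho>" "1 / growth \<rho> \<le> branch b \<rho>"
      using *(1) by (simp_all add: double_star_eq_def margin_branch)
    note br = this
    have q0: "0 < q \<rho> i" for i
      using pos iterate_ge[OF *(3) br(1), of i] unfolding q_def by (rule less_le_trans)
    have less: "q \<rho> i < q \<rho>' i" for i
    proof (induction i)
      case 0
      then show ?case using branch_strict_mono[OF *(3) lt] by (simp add: q_def)
    next
      case (Suc i)
      have "1 / q \<rho>' i \<le> 1 / q \<rho> i" using Suc q0[of i] by (simp add: frac_le)
      then show ?case using lt by (simp add: q_def)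
    qed
    have "0 < branch b \<rho>" using pos br(2) by (rule less_le_trans)
    then have "q \<rho> m * branch b \<rho> < q \<rho>' m * branch b \<rho>'"
      using branch_strict_mono[OF *(3) lt, of b] less[of m] q0[of m] by (intro mult_strict_mono) auto
    then show False using * by (simp add: double_star_eq_def q_def)
  qed
  from this[of \<rho> \<rho>'] this[of \<rho>' \<rho>] show ?thesis using assms by auto
qed

text \<open>The map q -> \<rho> - 1 / q has the repelling fixed point 1 / t and the attracting one
  t. From a start at least \<eta> above 1 / t, the distance t - q shrinks by the factor 1 + \<eta>
  per step, while the far end demands q = 1 / \<open>branch b \<rho>\<close>, a definite distance
  below t. So the connecting path cannot be long.\<close>

lemma double_star_eq_bound:
  assumes "2 < \<rho>" "0 < \<eta>" "double_star_eq \<rho> a b m" "\<eta> \<le> margin a \<rho>" "\<eta> \<le> margin b \<rho>"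
  shows "(1 + \<eta>) ^ m \<le> (1 + \<eta>) / \<eta>"
proof -
  define t where "t = growth \<rho>"
  have t: "t > 1" "t + 1 / t = \<rho>" using growth[OF assms(1)] by (auto simp: t_def)
  define q where "q = (\<lambda>i. ((\<lambda>q. \<rho> - 1 / q) ^^ i) (branch a \<rho>))"
  have qSuc: "q (Suc i) = \<rho> - 1 / q i" for i by (simp add: q_def)
  \<comment> \<open>Once the orbit has reached t it stays at or above t; before that it does not
    decrease and its distance to t decays geometrically.\<close>
  have inv: "t \<le> q i \<or> (1 / t + \<eta> \<le> q i \<and> q i < t \<and> (t - q i) * (1 + \<eta>) ^ i \<le> t)" for i
  proof (induction i)
    case 0
    have "1 / t + \<eta> \<le> q 0" using assms(4) by (simp add: q_def margin_branch t_def)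
    moreover have "0 < 1 / t" using t by simp
    ultimately have "0 \<le> q 0" using assms(2) by linarith
    then show ?case using \<open>1 / t + \<eta> \<le> q 0\<close> by auto
  next
    case (Suc i)
    have qpos: "q i > 0" using Suc t assms(2) by (smt (verit) zero_less_divide_1_iff)
    \<comment> \<open>The distance is divided by t q because \<rho> - t = 1 / t; in the second
      alternative t q >= 1 + \<eta>.\<close>
    have d: "t - q (Suc i) = (t - q i) / (t * q i)"
      using t qpos unfolding qSuc by (simp add: t(2)[symmetric] field_simps)
    show ?case
    proof (cases "t \<le> q i")
      case True
      then have "t - q (Suc i) \<le> 0" unfolding d using t qpos by (simp add: divide_nonpos_pos)
      then show ?thesis by simp
    next
      case False
      then have F: "1 / t + \<eta> \<le> q i" "q i < t" "(t - q i) * (1 + \<eta>) ^ i \<le> t" using Suc by auto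
      have "1 + \<eta> \<le> t * (1 / t + \<eta>)" using t assms(2) by (simp add: distrib_left)
      also have "\<dots> \<le> t * q i" using F t by (intro mult_left_mono) auto
      finally have tq: "1 + \<eta> \<le> t * q i" .
      have dpos: "0 < t - q (Suc i)" unfolding d using F t qpos by (intro divide_pos_pos) auto
      have "(t - q (Suc i)) * (1 + \<eta>) \<le> (t - q (Suc i)) * (t * q i)"
        using tq dpos by (intro mult_left_mono) auto
      also have "\<dots> = t - q i" unfolding d using t qpos by simp
      finally have le: "(t - q (Suc i)) * (1 + \<eta>) \<le> t - q i" .
      have "(t - q (Suc i)) * (1 + \<eta>) ^ Suc i = ((t - q (Suc i)) * (1 + \<eta>)) * (1 + \<eta>) ^ i" by simp
      also have "\<dots> \<le> (t - q i) * (1 + \<eta>) ^ i" using le assms(2) by (intro mult_right_mono) auto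
      finally have 1: "(t - q (Suc i)) * (1 + \<eta>) ^ Suc i \<le> t" using F by linarith
      have "(t - q (Suc i)) * 1 \<le> (t - q (Suc i)) * (1 + \<eta>)"
        using dpos assms(2) by (intro mult_left_mono) auto
      then have "(t - q (Suc i)) * 1 \<le> t - q i" using le by (rule order_trans)
      then have "q i \<le> q (Suc i)" by simp
      then show ?thesis using 1 F dpos by simp
    qed
  qed
  define g where "g = branch b \<rho>"
  have "1 / t + \<eta> \<le> g" using assms(5) by (simp add: g_def margin_branch t_def)
  then have "t * (1 / t + \<eta>) \<le> t * g" using t by (intro mult_left_mono) auto
  then have tg: "1 + t * \<eta> \<le> t * g" using t by (simp add: distrib_left)
  have qg: "q m * g = 1" using assms(3) by (simp add: double_star_eq_def q_def g_def)
  have tn: "0 < t * \<eta>" using t assms(2) by simp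
  have tg0: "0 < t * g" using tg tn by linarith
  then have g0: "0 < g" using t by (simp add: zero_less_mult_iff)
  have qm: "q m = 1 / g" using qg g0 by (simp add: field_simps)
  have d: "(t - q m) * (t * g) = t * (t * g - 1)" unfolding qm using g0 by (simp add: field_simps)
  \<comment> \<open>The far end lies strictly below t, which excludes the first alternative of the
    invariant.\<close>
  have "0 < (t - q m) * (t * g)" unfolding d using t tg tn by (intro mult_pos_pos) auto
  then have "q m < t" using tg0 by (simp add: zero_less_mult_iff)
  then have *: "(t - q m) * (1 + \<eta>) ^ m \<le> t" using inv[of m] by auto
  have "\<eta> / (1 + \<eta>) * t \<le> t - q m"
  proof -
    have "\<eta> * (t * g) \<le> (t * g - 1) * (1 + \<eta>)"
    proof -
      have "\<eta> * 1 \<le> \<eta> * t" using t assms(2) by (intro mult_left_mono) auto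
      then have "1 + \<eta> \<le> t * g" using tg by (simp add: mult.commute)
      then show ?thesis by (simp add: algebra_simps)
    qed
    then have "\<eta> / (1 + \<eta>) * (t * g) \<le> t * g - 1" using assms(2) by (simp add: field_simps)
    then have "t * (\<eta> / (1 + \<eta>) * (t * g)) \<le> t * (t * g - 1)" using t by (intro mult_left_mono) auto
    then have "(\<eta> / (1 + \<eta>) * t) * (t * g) \<le> (t - q m) * (t * g)" unfolding d by (simp add: mult_ac)
    then show ?thesis using tg0 by (simp only: mult_le_cancel_right_pos)
  qed
  then have "(\<eta> / (1 + \<eta>) * t) * (1 + \<eta>) ^ m \<le> (t - q m) * (1 + \<eta>) ^ m"
    using assms(2) by (intro mult_right_mono) auto
  then have "t * (\<eta> / (1 + \<eta>) * (1 + \<eta>) ^ m) \<le> t * 1" using * by (simp only: mult_ac mult_1_right mult_1_left)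
  then have "\<eta> / (1 + \<eta>) * (1 + \<eta>) ^ m \<le> 1" using t by (simp only: mult_le_cancel_left_pos)
  then show ?thesis using assms(2) by (simp add: field_simps)
qed

text \<open>The bound is 2 \<open>arm 2 \<gamma>\<close>, so two arms of two vertices together with
  a ratio 1 / t exceed \<gamma>. With t \<gamma> = t^2 + 1 the claim becomes t^4 + t^2 + 1 < 2 (t^2
  + 1).\<close>

lemma two_arms_2:
  assumes \<gamma>: "2 < \<gamma>" "\<gamma> < sqrt (2 + sqrt 5)"
  shows "growth \<gamma> < 2 * \<gamma> / (\<gamma>\<^sup>2 - 1)"
proof -
  note g = growth[OF \<gamma>(1)]
  define t where "t = growth \<gamma>"
  have t: "t > 1" "\<gamma> = t + 1 / t" "t ^ 4 < t ^ 2 + 1"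
    using g growth_bound_golden(1)[OF \<gamma>] by (auto simp: t_def)
  have "4 < \<gamma>\<^sup>2" using power_strict_mono[of 2 \<gamma> 2] \<gamma> by simp
  moreover have "t * (t * (\<gamma>\<^sup>2 - 1)) < t * (2 * \<gamma>)"
  proof -
    have "t * (t * (\<gamma>\<^sup>2 - 1)) = (t * \<gamma>)\<^sup>2 - t\<^sup>2" by (simp add: algebra_simps power2_eq_square)
    also have "t * \<gamma> = t\<^sup>2 + 1" using t by (simp add: distrib_left power2_eq_square)
    also have "(t\<^sup>2 + 1)\<^sup>2 - t\<^sup>2 = t ^ 4 + t\<^sup>2 + 1" by (simp add: power2_eq_square algebra_simps power4_eq_xxxx)
    also have "\<dots> < 2 * (t\<^sup>2 + 1)" using t by simp
    also have "t\<^sup>2 + 1 = t * \<gamma>" using t by (simp add: distrib_left power2_eq_square)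
    finally show ?thesis by simp
  qed
  ultimately have "t < 2 * \<gamma> / (\<gamma>\<^sup>2 - 1)" using t by (simp add: pos_less_divide_eq)
  then show ?thesis by (simp add: t_def)
qed

lemma eventually_not_in_finite_fibre:
  assumes "inj (f :: nat \<Rightarrow> 'a)" "finite S"
  shows "\<forall>\<^sub>F k in sequentially. f k \<notin> S"
proof -
  have "finite (f -` S)" using assms by (intro finite_vimageI)
  then show ?thesis
    unfolding cofinite_eq_sequentially[symmetric] eventually_cofinite by (simp add: vimage_def)
qed

text \<open>Distinct radii have distinct length triples, so the longest arm grows without bound and
  its ratio tends to 1 / t; the other two ratios sum to t in the limit. By \<open>two_arms_2\<close>
  the shortest arm is eventually a single vertex, and a negative margin keeps the middle arm below
  K. Each of the finitely many lengths n left would need \<open>margin n \<gamma>\<close> = 0, that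
  is \<gamma> = \<open>zeta n\<close>.\<close>

lemma star_limit:
  assumes inj: "inj r" and lim: "r \<longlonglongrightarrow> \<gamma>" and \<gamma>: "2 < \<gamma>" "\<gamma> < sqrt (2 + sqrt 5)"
    and r2: "\<And>k. 2 < r k" and star: "\<And>k. \<exists>a b c. star_eq (r k) a b c"
  shows "\<exists>n\<ge>1. \<gamma> = zeta n"
proof (rule ccontr)
  assume none: "\<not> ?thesis"
  from star obtain a b c where s: "star_eq (r k) (a k) (b k) (c k)" for k by metis
  have "inj (\<lambda>k. (a k, b k, c k))"
  proof (rule injI)
    fix k l assume "(a k, b k, c k) = (a l, b l, c l)"
    then have "r k = r l" using s[of k] s[of l] r2 by (metis star_eq_unique prod.inject)
    then show "k = l" using inj by (simp add: inj_eq)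
  qed
  then have ev: "\<forall>\<^sub>F k in sequentially. (a k, b k, c k) \<notin> {..M} \<times> {..M} \<times> {..M}" for M
    by (intro eventually_not_in_finite_fibre) auto
  have c: "filterlim c at_top sequentially"
    unfolding filterlim_at_top
  proof
    fix M
    show "\<forall>\<^sub>F k in sequentially. M \<le> c k"
      using ev[of M]
    proof eventually_elim
      case (elim k)
      then show ?case using s[of k] by (auto simp: star_eq_def)
    qed
  qed
  note g = growth[OF \<gamma>(1)]
  \<comment> \<open>A barrier between 2 and \<gamma> makes \<open>growth\<close> uniformly larger
    than 1, so the gap of the arm of length \<open>c k\<close> decays geometrically in
    \<open>c k\<close>.\<close>
  define \<rho>0 where "\<rho>0 = (2 + \<gamma>) / 2"
  have \<rho>0: "2 < \<rho>0" "\<rho>0 < \<gamma>" using \<gamma> by (auto simp: \<rho>0_def)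
  note g0 = growth[OF \<rho>0(1)]
  have gap: "(\<lambda>k. 1 / growth (r k) - arm (c k) (r k)) \<longlonglongrightarrow> 0"
  proof (rule tendsto_sandwich)
    show "\<forall>\<^sub>F k in sequentially. 0 \<le> 1 / growth (r k) - arm (c k) (r k)"
      using arm_less_inverse_growth[OF r2] by (simp add: less_imp_le)
    show "\<forall>\<^sub>F k in sequentially. 1 / growth (r k) - arm (c k) (r k) \<le> (1 / growth \<rho>0) ^ c k"
      using order_tendstoD(1)[OF lim \<rho>0(2)]
    proof eventually_elim
      case (elim k)
      have "growth \<rho>0 \<le> growth (r k)" using elim \<rho>0 by (intro growth_mono) auto
      then have "1 / growth (r k) ^ c k \<le> 1 / growth \<rho>0 ^ c k"
        using g0 by (intro divide_left_mono power_mono mult_pos_pos zero_less_power) auto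
      then show ?case
        using arm_gap[OF r2[of k], of "c k"] by (simp add: power_one_over)
    qed
    have "(\<lambda>n. (1 / growth \<rho>0) ^ n) \<longlonglongrightarrow> 0" using g0 by (intro LIMSEQ_realpow_zero) auto
    then show "(\<lambda>k. (1 / growth \<rho>0) ^ c k) \<longlonglongrightarrow> 0" using c by (rule filterlim_compose)
  qed simp
  have "(\<lambda>k. r k - 1 / growth (r k) + (1 / growth (r k) - arm (c k) (r k))) \<longlonglongrightarrow> \<gamma> - 1 / growth \<gamma> + 0"
    using g by (intro tendsto_intros lim gap tendsto_growth) auto
  moreover have "\<gamma> - 1 / growth \<gamma> + 0 = growth \<gamma>" using g(2) by linarith
  ultimately have e: "(\<lambda>k. r k - arm (c k) (r k)) \<longlonglongrightarrow> growth \<gamma>" by simp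
  have lt: "growth \<gamma> - 2 * arm 2 \<gamma> < 0"
    using two_arms_2[OF \<gamma>] by (simp add: arm_2[OF \<gamma>(1)])
  have "(\<lambda>k. (r k - arm (c k) (r k)) - 2 * arm 2 (r k)) \<longlonglongrightarrow> growth \<gamma> - 2 * arm 2 \<gamma>"
    using \<gamma> by (intro tendsto_intros e tendsto_arm lim)
  then have E1: "\<forall>\<^sub>F k in sequentially. (r k - arm (c k) (r k)) - 2 * arm 2 (r k) < 0"
    using lt by (rule order_tendstoD(2))
  have m: "(\<lambda>k. (r k - arm (c k) (r k)) - 1 / r k - arm n (r k)) \<longlonglongrightarrow> margin n \<gamma>" for n
  proof -
    have "(\<lambda>k. (r k - arm (c k) (r k)) - 1 / r k - arm n (r k)) \<longlonglongrightarrow> growth \<gamma> - 1 / \<gamma> - arm n \<gamma>"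
      using \<gamma> by (intro tendsto_intros e tendsto_arm lim) auto
    moreover have "growth \<gamma> - 1 / \<gamma> - arm n \<gamma> = margin n \<gamma>" using g(2) unfolding margin_def by linarith
    ultimately show ?thesis by simp
  qed
  obtain K where K: "margin K \<gamma> < 0" using margin_eventually_neg[OF \<gamma>] .
  have E2: "\<forall>\<^sub>F k in sequentially. (r k - arm (c k) (r k)) - 1 / r k - arm K (r k) < 0"
    using m K by (rule order_tendstoD(2))
  have "\<forall>\<^sub>F k in sequentially. \<forall>n\<in>{1..<K}. (r k - arm (c k) (r k)) - 1 / r k - arm n (r k) \<noteq> 0"
  proof (rule eventually_ball_finite; clarsimp)
    fix n assume "Suc 0 \<le> n"
    then have "margin n \<gamma> \<noteq> 0" using none zeta_eqI[of n \<gamma>] \<gamma> by auto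
    with m[of n] show "\<forall>\<^sub>F k in sequentially. (r k - arm (c k) (r k)) - 1 / r k \<noteq> arm n (r k)"
      using tendsto_imp_eventually_ne[of _ "margin n \<gamma>" sequentially 0] by fastforce
  qed
  \<comment> \<open>The three facts exclude in turn a >= 2, then b >= K, then 1 <= b < K.\<close>
  with E1 E2 have "\<forall>\<^sub>F k in sequentially. False"
  proof eventually_elim
    case (elim k)
    have eq: "r k - arm (c k) (r k) = arm (a k) (r k) + arm (b k) (r k)"
      and ab: "1 \<le> a k" "a k \<le> b k" using s[of k] by (auto simp: star_eq_def)
    show ?case
    proof (cases "a k = 1")
      case False
      then have "arm 2 (r k) \<le> arm (a k) (r k)" "arm 2 (r k) \<le> arm (b k) (r k)"
        using ab r2[of k] by (auto intro!: arm_mono_index)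
      then show ?thesis using elim(1) eq by linarith
    next
      case True
      then have eq': "(r k - arm (c k) (r k)) - 1 / r k = arm (b k) (r k)" using eq by (simp add: arm_1)
      show ?thesis
      proof (cases "b k < K")
        case True
        then show ?thesis using elim(3) eq' ab by auto
      next
        case False
        then have "arm K (r k) \<le> arm (b k) (r k)" using r2[of k] by (intro arm_mono_index) auto
        then show ?thesis using elim(2) eq' by linarith
      qed
    qed
  qed
  then show False by simp
qed

text \<open>Nonnegative margins force a and b below K. If \<gamma> is no \<open>zeta n\<close>, the
  margins of these finitely many lengths stay at least \<eta> away from 0, so
  \<open>double_star_eq_bound\<close> bounds m too; but infinitely many radii need infinitely many
  triples.\<close>

lemma double_star_limit:
  assumes inj: "inj r" and lim: "r \<longlonglongrightarrow> \<gamma>" and \<gamma>: "2 < \<gamma>" "\<gamma> < sqrt (2 + sqrt 5)"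
    and r2: "\<And>k. 2 < r k" and star: "\<And>k. \<exists>a b m. double_star_eq (r k) a b m"
  shows "\<exists>n\<ge>1. \<gamma> = zeta n"
proof (rule ccontr)
  assume none: "\<not> ?thesis"
  from star obtain a b m where s: "double_star_eq (r k) (a k) (b k) (m k)" for k by metis
  have "inj (\<lambda>k. (a k, b k, m k))"
  proof (rule injI)
    fix k l assume "(a k, b k, m k) = (a l, b l, m l)"
    then have "r k = r l" using s[of k] s[of l] r2 by (metis double_star_eq_unique prod.inject)
    then show "k = l" using inj by (simp add: inj_eq)
  qed
  then have ev: "\<forall>\<^sub>F k in sequentially. (a k, b k, m k) \<notin> {..<K} \<times> {..<K} \<times> {..M}" for K M
    by (intro eventually_not_in_finite_fibre) auto
  obtain K where K: "margin K \<gamma> < 0" using margin_eventually_neg[OF \<gamma>] .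
  have E1: "\<forall>\<^sub>F k in sequentially. margin K (r k) < 0"
    by (rule order_tendstoD(2)[OF tendsto_margin[OF lim \<gamma>(1)] K])
  \<comment> \<open>Half the least distance at \<gamma>, so that the bound persists for radii near
    \<gamma>; the inserted 1 covers an empty range of lengths.\<close>
  define \<eta> where "\<eta> = Min (insert 1 ((\<lambda>n. \<bar>margin n \<gamma>\<bar>) ` {1..<K})) / 2"
  have nz: "margin n \<gamma> \<noteq> 0" if "n \<in> {1..<K}" for n
    using none zeta_eqI[of n \<gamma>] \<gamma> that by auto
  have M0: "Min (insert 1 ((\<lambda>n. \<bar>margin n \<gamma>\<bar>) ` {1..<K})) > 0" using nz by simp
  then have \<eta>0: "\<eta> > 0" by (simp add: \<eta>_def)
  have \<eta>: "\<eta> < \<bar>margin n \<gamma>\<bar>" if "n \<in> {1..<K}" for n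
  proof -
    have "Min (insert 1 ((\<lambda>n. \<bar>margin n \<gamma>\<bar>) ` {1..<K})) \<le> \<bar>margin n \<gamma>\<bar>"
      using that by (intro Min_le) auto
    then show ?thesis using M0 unfolding \<eta>_def by linarith
  qed
  have E2: "\<forall>\<^sub>F k in sequentially. \<forall>n\<in>{1..<K}. \<eta> < \<bar>margin n (r k)\<bar>"
  proof (rule eventually_ball_finite)
    show "\<forall>n\<in>{1..<K}. \<forall>\<^sub>F k in sequentially. \<eta> < \<bar>margin n (r k)\<bar>"
      using \<eta> by (intro ballI order_tendstoD(1)[OF tendsto_rabs[OF tendsto_margin[OF lim \<gamma>(1)]]])
  qed simp
  obtain M where M: "(1 + \<eta>) / \<eta> < (1 + \<eta>) ^ M"
    using real_arch_pow[of "1 + \<eta>" "(1 + \<eta>) / \<eta>"] \<eta>0 by auto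
  have "\<forall>\<^sub>F k in sequentially. False"
    using E1 E2 ev[of K M]
  proof eventually_elim
    case (elim k)
    have S: "1 \<le> a k" "1 \<le> b k" "0 \<le> margin (a k) (r k)" "0 \<le> margin (b k) (r k)"
      using s[of k] by (auto simp: double_star_eq_def)
    have lt: "n < K" if "0 \<le> margin n (r k)" for n
      using margin_antimono_index[OF r2[of k], of K n] that elim(1) by (cases "n < K") auto
    have ab: "a k < K" "b k < K" using lt S by auto
    then have "\<eta> \<le> margin (a k) (r k)" "\<eta> \<le> margin (b k) (r k)" using elim(2) S by force+
    then have "(1 + \<eta>) ^ m k \<le> (1 + \<eta>) / \<eta>"
      using double_star_eq_bound[OF r2[of k] \<eta>0 s[of k]] by simp
    moreover have "(1 + \<eta>) ^ M \<le> (1 + \<eta>) ^ m k"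
      using elim(3) ab \<eta>0 by (intro power_increasing) auto
    ultimately show ?case using M by linarith
  qed
  then show False by simp
qed

section \<open>Positive eigenvectors on graphs\<close>

lemma card_2_member:
  assumes "card S = 2" "u \<in> S"
  shows "\<exists>w. S = {u, w} \<and> w \<noteq> u"
proof -
  have "card (S - {u}) = 1" using assms by simp
  then obtain w where "S - {u} = {w}" by (auto simp: card_1_singleton_iff)
  then show ?thesis using assms(2) by (intro exI[of _ w]) auto
qed

lemma card_3_member:
  assumes "card S = 3" "u \<in> S"
  shows "\<exists>v w. S = {u, v, w} \<and> u \<noteq> v \<and> u \<noteq> w \<and> v \<noteq> w"
proof -
  have "card (S - {u}) = 2" using assms by simp
  then obtain v w where vw: "S - {u} = {v, w}" "v \<noteq> w" by (auto simp: card_2_iff)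
  have "S = insert u (S - {u})" using assms(2) by blast
  then have "S = {u, v, w}" by (simp only: vw)
  moreover have "u \<noteq> v" "u \<noteq> w" using vw(1) by blast+
  ultimately show ?thesis using vw(2) by blast
qed

lemma star_eq_perm:
  assumes "1 \<le> i \<and> 1 \<le> j \<and> 1 \<le> k" "\<rho> = arm i \<rho> + arm j \<rho> + arm k \<rho>"
  shows "\<exists>a b c. star_eq \<rho> a b c"
proof -
  have eq: "arm i \<rho> + arm k \<rho> + arm j \<rho> = \<rho>" "arm j \<rho> + arm i \<rho> + arm k \<rho> = \<rho>"
    "arm j \<rho> + arm k \<rho> + arm i \<rho> = \<rho>" "arm k \<rho> + arm i \<rho> + arm j \<rho> = \<rho>"
    "arm k \<rho> + arm j \<rho> + arm i \<rho> = \<rho>"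
    using assms(2) by linarith+
  have *: "\<exists>a b c. star_eq \<rho> a b c" if "1 \<le> a" "a \<le> b \<and> b \<le> c" "arm a \<rho> + arm b \<rho> + arm c \<rho> = \<rho>" for a b c
    unfolding star_eq_def 
  proof (intro exI conjI)
    show "1 \<le> a" "a \<le> b" "b \<le> c" "\<rho> = arm a \<rho> + arm b \<rho> + arm c \<rho>"
      using that(1,2) that(3)[symmetric] by (simp_all only:)
  qed
  have pos: "1 \<le> i" "1 \<le> j" "1 \<le> k" using assms(1) by auto
  consider "i \<le> j \<and> j \<le> k" | "i \<le> k \<and> k \<le> j" | "j \<le> i \<and> i \<le> k" | "j \<le> k \<and> k \<le> i"
    | "k \<le> i \<and> i \<le> j" | "k \<le> j \<and> j \<le> i"
    using nat_le_linear[of i j] nat_le_linear[of j k] nat_le_linear[of i k] by blast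
  then show ?thesis
  proof cases
    case 1 show ?thesis using *[OF pos(1) 1 assms(2)[symmetric]] .
  next
    case 2 show ?thesis using *[OF pos(1) 2 eq(1)] .
  next
    case 3 show ?thesis using *[OF pos(2) 3 eq(2)] .
  next
    case 4 show ?thesis using *[OF pos(2) 4 eq(3)] .
  next
    case 5 show ?thesis using *[OF pos(3) 5 eq(4)] .
  next
    case 6 show ?thesis using *[OF pos(3) 6 eq(5)] .
  qed
qed

text \<open>\<open>C\<close> stands for the support of the modulus of an eigenvector, a union of
  components of the graph.\<close>

locale eigen_component =
  fixes N :: "'a \<Rightarrow> 'a set" and C :: "'a set" and y :: "'a \<Rightarrow> real" and \<rho> :: real
  assumes finite_C: "finite C"
    and nonempty_C: "C \<noteq> {}"
    and closed: "v \<in> C \<Longrightarrow> N v \<subseteq> C"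
    and sym: "w \<in> N v \<longleftrightarrow> v \<in> N w"
    and pos: "v \<in> C \<Longrightarrow> 0 < y v"
    and eig: "v \<in> C \<Longrightarrow> (\<Sum>w\<in>N v. y w) = \<rho> * y v"
begin

lemma finite_N: "v \<in> C \<Longrightarrow> finite (N v)"
  using closed finite_C finite_subset by blast

lemma sum_subset_le:
  assumes "v \<in> C" "S \<subseteq> N v"
  shows "(\<Sum>w\<in>S. y w) \<le> \<rho> * y v"
proof -
  have "(\<Sum>w\<in>S. y w) \<le> (\<Sum>w\<in>N v. y w)"
    using assms finite_N[OF assms(1)] closed[OF assms(1)]
    by (intro sum_mono2) (auto intro: less_imp_le pos)
  then show ?thesis by (simp add: eig[OF assms(1)])
qed

lemma nbr_le:
  assumes "v \<in> C" "w \<in> N v"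
  shows "y v \<le> \<rho> * y w"
  using sum_subset_le[of w "{v}"] assms closed sym by auto

text \<open>Each neighbour of v has value at least y v / \<rho>, and these values sum to \<rho> y
  v.\<close>

lemma card_le_square:
  assumes "v \<in> C" "0 < \<rho>"
  shows "real (card (N v)) \<le> \<rho>\<^sup>2"
proof -
  have "real (card (N v)) * (y v / \<rho>) = (\<Sum>w\<in>N v. y v / \<rho>)" by simp
  also have "\<dots> \<le> (\<Sum>w\<in>N v. y w)"
    using nbr_le[OF assms(1)] assms(2) by (intro sum_mono) (simp add: pos_divide_le_eq mult.commute)
  also have "\<dots> = \<rho>\<^sup>2 * (y v / \<rho>)" using assms by (simp add: eig power2_eq_square)
  finally show ?thesis
    by (rule mult_right_le_imp_le) (use pos[OF assms(1)] assms(2) in simp)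
qed

section \<open>Directed edges, their ratios and walks through vertices of degree 2\<close>

definition edge :: "'a \<times> 'a \<Rightarrow> bool" where
  "edge e \<longleftrightarrow> fst e \<in> C \<and> snd e \<in> N (fst e)"

definition ratio :: "'a \<times> 'a \<Rightarrow> real" where
  "ratio e = y (snd e) / y (fst e)"

definition step :: "'a \<times> 'a \<Rightarrow> 'a \<times> 'a \<Rightarrow> bool" where
  "step e f \<longleftrightarrow> fst f = snd e \<and> N (snd e) = {fst e, snd f} \<and> fst e \<noteq> snd f"

lemma edge_snd: "edge e \<Longrightarrow> snd e \<in> C"
  using closed by (auto simp: edge_def)

lemma edge_swap: "edge e \<Longrightarrow> edge (prod.swap e)"
  using edge_snd sym by (auto simp: edge_def)

lemma ratio_pos: "edge e \<Longrightarrow> 0 < ratio e"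
  using pos edge_snd by (auto simp: ratio_def edge_def)

lemma ratio_swap: "ratio (prod.swap e) = 1 / ratio e"
  by (simp add: ratio_def)

lemma ratio_ge: "edge e \<Longrightarrow> 0 < \<rho> \<Longrightarrow> 1 / \<rho> \<le> ratio e"
  using nbr_le[of "fst e" "snd e"] pos[of "fst e"] by (simp add: edge_def ratio_def field_simps)

lemma step_edge: "edge e \<Longrightarrow> step e f \<Longrightarrow> edge f"
  using edge_snd by (auto simp: edge_def step_def)

lemma steps_edge: "(step ^^ L) e f \<Longrightarrow> edge e \<Longrightarrow> edge f"
  by (induction L arbitrary: f) (auto intro: step_edge)

lemma step_swap: "step e f \<Longrightarrow> step (prod.swap f) (prod.swap e)"
  by (auto simp: step_def)

lemma steps_swap: "(step ^^ L) e f \<Longrightarrow> (step ^^ L) (prod.swap f) (prod.swap e)"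
proof (induction L arbitrary: f)
  case (Suc L)
  then obtain g where "(step ^^ L) e g" "step g f" by auto
  then show ?case using Suc.IH step_swap relpowp_Suc_I2 by metis
qed simp

lemma step_ratio:
  assumes "edge e" "step e f"
  shows "ratio f = \<rho> - 1 / ratio e"
proof -
  have "y (fst e) + y (snd f) = \<rho> * y (snd e)"
    using assms eig[OF edge_snd[OF assms(1)]] by (simp add: step_def)
  then show ?thesis using assms pos[OF edge_snd[OF assms(1)]]
    by (simp add: ratio_def step_def field_simps)
qed

lemma steps_ratio:
  "(step ^^ L) e f \<Longrightarrow> edge e \<Longrightarrow> ratio f = ((\<lambda>q. \<rho> - 1 / q) ^^ L) (ratio e)"
proof (induction L arbitrary: f)
  case (Suc L)
  then obtain g where "(step ^^ L) e g" "step g f" by auto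
  then show ?case using Suc step_ratio[OF steps_edge] by simp
qed simp

lemma step_ratio_back:
  assumes "edge e" "step e f"
  shows "ratio e = 1 / (\<rho> - ratio f)"
  using step_ratio[OF assms] by simp

lemma steps_arm:
  assumes "(step ^^ L) e f" "edge e" "ratio f = arm k \<rho>"
  shows "ratio e = arm (L + k) \<rho>"
  using assms
proof (induction L arbitrary: e)
  case (Suc L)
  from relpowp_Suc_D2[OF Suc.prems(1)] obtain g where g: "step e g" "(step ^^ L) g f" by blast
  then have "ratio g = arm (L + k) \<rho>" using Suc step_edge by blast
  then show ?case using step_ratio_back[OF Suc.prems(2) g(1)] by simp
qed simp

lemma ratio_sum_3:
  assumes "v \<in> C" "N v = {w1, w2, w3}" "w1 \<noteq> w2" "w1 \<noteq> w3" "w2 \<noteq> w3"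
  shows "ratio (v, w1) + ratio (v, w2) + ratio (v, w3) = \<rho>"
proof -
  have "y w1 + y w2 + y w3 = \<rho> * y v" using eig[OF assms(1)] assms by (simp add: add.assoc)
  then have "(y w1 + y w2 + y w3) / y v = \<rho>" using pos[OF assms(1)] by simp
  then show ?thesis by (simp add: ratio_def add_divide_distrib)
qed

text \<open>With \<open>\<rho> > 2\<close>, the eigenvector is strictly convex along a path of vertices of degree 2, so such
  a path cannot be continued forever.\<close>

lemma steps_terminate:
  assumes "2 < \<rho>" "edge e"
  shows "\<exists>L f. (step ^^ L) e f \<and> card (N (snd f)) \<noteq> 2"
proof (rule ccontr)
  assume "\<not> ?thesis"
  then have all2: "(step ^^ L) e f \<Longrightarrow> card (N (snd f)) = 2" for L f by blast
  define \<epsilon> where "\<epsilon> = (\<rho> - 2) * Min (y ` C)"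
  have Min: "Min (y ` C) > 0" using finite_C nonempty_C pos by simp
  then have \<epsilon>: "\<epsilon> > 0" using assms by (simp add: \<epsilon>_def)
  \<comment> \<open>The increment of y along the path grows by at least \<epsilon> per step, since
    the second difference at a vertex of degree 2 is (\<rho> - 2) times its value.\<close>
  have *: "\<exists>f. (step ^^ L) e f \<and> y (snd e) - y (fst e) + L * \<epsilon> \<le> y (snd f) - y (fst f)" for L
  proof (induction L)
    case (Suc L)
    then obtain f where f: "(step ^^ L) e f" "y (snd e) - y (fst e) + L * \<epsilon> \<le> y (snd f) - y (fst f)"
      by blast
    have ef: "edge f" using f assms steps_edge by blast
    then have "fst f \<in> N (snd f)" using sym by (auto simp: edge_def)
    from card_2_member[OF all2[OF f(1)] this] obtain w
      where w: "N (snd f) = {fst f, w}" "w \<noteq> fst f" by blast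
    then have st: "step f (snd f, w)" by (auto simp: step_def)
    have "y (fst f) + y w = \<rho> * y (snd f)" using eig[OF edge_snd[OF ef]] w by simp
    moreover have "\<epsilon> \<le> (\<rho> - 2) * y (snd f)"
      unfolding \<epsilon>_def using edge_snd[OF ef] finite_C assms by (intro mult_left_mono Min_le) auto
    ultimately have "y (snd f) - y (fst f) + \<epsilon> \<le> y w - y (snd f)" by (simp add: algebra_simps)
    moreover have "(step ^^ Suc L) e (snd f, w)" using f(1) st by (rule relpowp_Suc_I)
    ultimately show ?case using f(2) by (intro exI[of _ "(snd f, w)"]) (auto simp: algebra_simps)
  qed (use assms in auto)
  obtain L where L: "Max (y ` C) + y (fst e) < real L * \<epsilon>" using reals_Archimedean3[OF \<epsilon>] by blast
  obtain f where f: "(step ^^ L) e f" "y (snd e) - y (fst e) + L * \<epsilon> \<le> y (snd f) - y (fst f)"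
    using * by blast
  have ef: "edge f" using f assms steps_edge by blast
  have "y (snd f) \<le> Max (y ` C)" using finite_C edge_snd[OF ef] by (intro Max_ge) auto
  moreover have "0 < y (fst f)" "0 < y (snd e)" using ef pos assms edge_snd by (auto simp: edge_def)
  ultimately show False using f(2) L by linarith
qed

text \<open>At a vertex v where y is largest, \<rho> y v is a sum over the neighbours with no term
  above y v, so the degree is at least \<rho>.\<close>

lemma exists_branch_vertex:
  assumes "2 < \<rho>"
  shows "\<exists>v\<in>C. 3 \<le> card (N v)"
proof -
  have "Max (y ` C) \<in> y ` C" using finite_C nonempty_C by (intro Max_in) auto
  then obtain v where v: "v \<in> C" "y v = Max (y ` C)" by auto
  have le: "y w \<le> y v" if "w \<in> C" for w
    unfolding v(2) using that finite_C by (intro Max_ge) auto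
  have "\<rho> * y v = (\<Sum>w\<in>N v. y w)" using v by (simp add: eig)
  also have "\<dots> \<le> (\<Sum>w\<in>N v. y v)" using closed[OF v(1)] by (intro sum_mono le) auto
  finally have "\<rho> \<le> card (N v)" using pos[OF v(1)] by simp
  then have "3 \<le> card (N v)" using assms by linarith
  then show ?thesis using v by blast
qed

text \<open>The head of \<open>e\<close> has a further neighbour, whose value is at least 1 / \<rho>
  times that of the head; the eigenvalue equation at the head then makes its ratio at least that of
  an arm of two vertices.\<close>

lemma ratio_ge_arm_2:
  assumes "2 < \<rho>" "edge e" "N (snd e) \<noteq> {fst e}"
  shows "arm 2 \<rho> \<le> ratio e"
proof -
  have "fst e \<in> N (snd e)" using assms sym by (auto simp: edge_def)
  then obtain w where w: "w \<in> N (snd e)" "w \<noteq> fst e" using assms(3) by blast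
  have "(\<Sum>u\<in>{fst e, w}. y u) \<le> \<rho> * y (snd e)"
    using w \<open>fst e \<in> N (snd e)\<close> by (intro sum_subset_le edge_snd assms) auto
  then have 1: "y (fst e) + y w \<le> \<rho> * y (snd e)" using w by simp
  have "y (snd e) \<le> \<rho> * y w" using nbr_le[OF edge_snd[OF assms(2)] w(1)] .
  then have "\<rho> * y (fst e) + y (snd e) \<le> \<rho> * (\<rho> * y (snd e))"
    using mult_left_mono[OF 1, of \<rho>] assms(1) by (simp add: distrib_left)
  then have "\<rho> * y (fst e) \<le> (\<rho>\<^sup>2 - 1) * y (snd e)" by (simp add: algebra_simps power2_eq_square)
  moreover have "4 < \<rho>\<^sup>2" using power_strict_mono[of 2 \<rho> 2] assms by simp
  moreover have "0 < y (fst e)" using assms pos by (simp add: edge_def)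
  ultimately have "\<rho> / (\<rho>\<^sup>2 - 1) \<le> y (snd e) / y (fst e)" by (simp add: pos_le_divide_eq pos_divide_le_eq mult.commute)
  then show ?thesis by (simp add: arm_2[OF assms(1)] ratio_def)
qed

text \<open>Suppose the degree is at least 4. If all neighbours are leaves, \<rho>^2 is an integer
  strictly between 4 and 5. Otherwise one neighbour contributes \<open>arm 2 \<rho>\<close> and
  three others 1 / \<rho> each; for x = \<rho>^2 this yields 1 <= (x - 4)(x - 1), yet the right side
  is at most 3 - sqrt 5 < 1.\<close>

lemma card_le_3:
  assumes \<rho>: "2 < \<rho>" "\<rho> < sqrt (2 + sqrt 5)" and v: "v \<in> C"
  shows "card (N v) \<le> 3"
proof (rule ccontr)
  assume "\<not> ?thesis"
  then have c4: "4 \<le> card (N v)" by simp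
  have sq: "4 < \<rho>\<^sup>2" using power_strict_mono[of 2 \<rho> 2] \<rho> by simp
  have sq2: "\<rho>\<^sup>2 < 2 + sqrt 5" by (rule growth_bound_golden(3)[OF \<rho>])
  have s5: "2 < sqrt (5::real)" "sqrt (5::real) < 3" "sqrt 5 * sqrt 5 = (5::real)"
    by (auto intro: real_less_rsqrt real_less_lsqrt)
  have yv: "0 < y v" using pos v .
  show False
  proof (cases "\<forall>w\<in>N v. N w = {v}")
    case True
    have "y w = y v / \<rho>" if "w \<in> N v" for w
      using eig[of w] closed[OF v] that True \<rho> by (auto simp: field_simps)
    then have "\<rho> * y v = real (card (N v)) * (y v / \<rho>)" using eig[OF v] by simp
    then have "\<rho>\<^sup>2 = real (card (N v))" using yv \<rho> by (simp add: field_simps power2_eq_square)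
    then have "4 < real (card (N v))" "real (card (N v)) < 5" using sq sq2 s5(2) by auto
    then have "4 < card (N v)" "card (N v) < 5" by simp_all
    then show False by simp
  next
    case False
    then obtain w where w: "w \<in> N v" "N w \<noteq> {v}" by blast
    have "arm 2 \<rho> \<le> ratio (v, w)" using w v by (intro ratio_ge_arm_2 \<rho>) (auto simp: edge_def)
    then have w': "arm 2 \<rho> * y v \<le> y w" using yv by (simp add: ratio_def pos_le_divide_eq)
    have "3 * (y v / \<rho>) \<le> real (card (N v - {w})) * (y v / \<rho>)"
      using c4 w yv \<rho> finite_N[OF v] by (intro mult_right_mono) auto
    also have "\<dots> = (\<Sum>u\<in>N v - {w}. y v / \<rho>)" by simp
    also have "\<dots> \<le> (\<Sum>u\<in>N v - {w}. y u)"
      using nbr_le[OF v] \<rho> by (intro sum_mono) (simp add: pos_divide_le_eq mult.commute)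
    also have "\<dots> = \<rho> * y v - y w" using sum.remove[OF finite_N[OF v] w(1), of y] by (simp add: eig[OF v])
    finally have "3 * (y v / \<rho>) + arm 2 \<rho> * y v \<le> \<rho> * y v" using w' by linarith
    then have "(3 / \<rho> + arm 2 \<rho>) * y v \<le> \<rho> * y v" by (simp add: distrib_right)
    then have "3 / \<rho> + \<rho> / (\<rho>\<^sup>2 - 1) \<le> \<rho>" using yv by (simp add: arm_2[OF \<rho>(1)])
    then have "\<rho> * (3 / \<rho> + \<rho> / (\<rho>\<^sup>2 - 1)) \<le> \<rho> * \<rho>" using \<rho> by (intro mult_left_mono) auto
    moreover define x where "x = \<rho>\<^sup>2"
    ultimately have "3 + x / (x - 1) \<le> x" using \<rho> by (simp add: distrib_left power2_eq_square)
    then have "x / (x - 1) \<le> x - 3" by simp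
    then have "x \<le> (x - 3) * (x - 1)" using sq by (simp add: x_def pos_divide_le_eq)
    then have "1 \<le> (x - 4) * (x - 1)" by (simp add: algebra_simps)
    also have "\<dots> \<le> (sqrt 5 - 2) * (1 + sqrt 5)"
      using sq sq2 by (intro mult_mono) (auto simp: x_def)
    also have "\<dots> = 3 - sqrt 5" using s5(3) by (simp add: algebra_simps)
    finally show False using s5 by linarith
  qed
qed

text \<open>Degrees never exceed 3 in the range considered, so this says that the path starting with
  \<open>e\<close> runs into a branch vertex rather than a leaf.\<close>

definition fork :: "'a \<times> 'a \<Rightarrow> bool" where
  "fork e \<longleftrightarrow> (\<exists>L f. (step ^^ L) e f \<and> card (N (snd f)) = 3)"

lemma steps_ratio_ge:
  assumes "(step ^^ L) e f" "edge e" "2 < \<rho>" "1 / growth \<rho> \<le> ratio f"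
  shows "1 / growth \<rho> \<le> ratio e"
  using assms(1,2)
proof (induction L arbitrary: e)
  case (Suc L)
  note g = growth[OF assms(3)]
  from relpowp_Suc_D2[OF Suc.prems(1)] obtain h where h: "step e h" "(step ^^ L) h f" by blast
  then have h1: "1 / growth \<rho> \<le> ratio h" using Suc step_edge by blast
  have re: "ratio e = 1 / (\<rho> - ratio h)" using step_ratio_back[OF Suc.prems(2) h(1)] .
  have "0 < \<rho> - ratio h" using ratio_pos[OF Suc.prems(2)] unfolding re by simp
  moreover have "\<rho> - ratio h \<le> growth \<rho>" using h1 g by linarith
  ultimately show ?case unfolding re by (simp add: frac_le)
qed (use assms in simp)

text \<open>At the branch vertex the two edges leading on take at least 2 / \<rho> >= 1 / t of the
  total \<rho>, so the edge backwards has ratio at most \<rho> - 1 / t = t. Inverting gives the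
  bound for the last edge, and it propagates back along the path.\<close>

lemma fork_ratio_ge:
  assumes "fork e" "edge e" "2 < \<rho>"
  shows "1 / growth \<rho> \<le> ratio e"
proof -
  note g = growth[OF assms(3)]
  obtain L f where f: "(step ^^ L) e f" "card (N (snd f)) = 3" using assms(1) by (auto simp: fork_def)
  have ef: "edge f" using f assms steps_edge by blast
  have inC: "snd f \<in> C" using edge_snd[OF ef] .
  have "fst f \<in> N (snd f)" using ef sym by (auto simp: edge_def)
  then obtain w1 w2 where w: "N (snd f) = {fst f, w1, w2}" "fst f \<noteq> w1" "fst f \<noteq> w2" "w1 \<noteq> w2"
    using card_3_member[OF f(2)] by blast
  have "ratio (snd f, fst f) + ratio (snd f, w1) + ratio (snd f, w2) = \<rho>"
    using inC w by (intro ratio_sum_3)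
  moreover have "1 / \<rho> \<le> ratio (snd f, w1)" "1 / \<rho> \<le> ratio (snd f, w2)"
    using inC w assms by (auto intro!: ratio_ge simp: edge_def)
  moreover have "ratio (snd f, fst f) = 1 / ratio f" by (simp add: ratio_def)
  ultimately have 1: "1 / ratio f \<le> \<rho> - 2 / \<rho>" by simp
  have "1 / growth \<rho> \<le> 2 / \<rho>"
  proof -
    have "1 / growth \<rho> < 1" using g by simp
    then have "\<rho> \<le> 2 * growth \<rho>" using g by linarith
    then show ?thesis using g assms(3) by (simp add: divide_simps)
  qed
  then have "1 / ratio f \<le> growth \<rho>" using 1 g by linarith
  then have "1 / growth \<rho> \<le> ratio f" using g ratio_pos[OF ef] by (simp add: field_simps)
  then show ?thesis using steps_ratio_ge f assms by blast
qed

lemma arm_or_fork: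
  assumes "2 < \<rho>" "\<rho> < sqrt (2 + sqrt 5)" "edge e" "\<not> fork e"
  shows "\<exists>k\<ge>1. ratio e = arm k \<rho>"
proof -
  obtain L f where f: "(step ^^ L) e f" "card (N (snd f)) \<noteq> 2" using steps_terminate assms by blast
  have ef: "edge f" using f assms steps_edge by blast
  have "card (N (snd f)) \<le> 3" using card_le_3 assms edge_snd[OF ef] by blast
  moreover have "card (N (snd f)) \<noteq> 3" using f(1) assms(4) unfolding fork_def by blast
  moreover have fin: "finite (N (snd f))" and mem: "fst f \<in> N (snd f)"
    using finite_N edge_snd[OF ef] ef sym by (auto simp: edge_def)
  then have "card (N (snd f)) \<noteq> 0" by auto
  ultimately have "card (N (snd f)) = 1" using f(2) by linarith
  then have "N (snd f) = {fst f}" using mem by (auto simp: card_1_singleton_iff)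
  then have "y (fst f) = \<rho> * y (snd f)" using eig[OF edge_snd[OF ef]] by simp
  then have "ratio f = arm 1 \<rho>" using pos[OF edge_snd[OF ef]] assms(1) by (simp add: ratio_def)
  \<comment> \<open>The last edge, into the leaf, is itself an arm of one vertex, hence
    \<open>L + 1\<close>.\<close>
  then have "ratio e = arm (L + 1) \<rho>" using steps_arm f(1) assms(3) by blast
  then show ?thesis by (intro exI[of _ "L + 1"]) simp
qed

text \<open>The ratios around the vertex sum to \<rho>. A second fork would make them at least 2 / t
  + 1 / \<rho> > \<rho>, so the other two edges start arms, and by \<open>two_arms_2\<close> one of
  these is a single vertex. What remains for \<open>e\<close> is \<open>branch b \<rho>\<close>; by
  \<open>fork_ratio_ge\<close> its margin is nonnegative.\<close>

lemma fork_at_branch_vertex: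
  assumes \<rho>: "2 < \<rho>" "\<rho> < sqrt (2 + sqrt 5)" and e: "edge e" "fork e" "card (N (fst e)) = 3"
  shows "\<exists>b\<ge>1. 0 \<le> margin b \<rho> \<and> ratio e = branch b \<rho>"
proof -
  define t where "t = growth \<rho>"
  have t: "t > 1" "\<rho> = t + 1 / t" "t ^ 4 < t ^ 2 + 1"
    using growth[OF \<rho>(1)] growth_bound_golden(1)[OF \<rho>] by (auto simp: t_def)
  obtain v w1 where vw: "e = (v, w1)" by (cases e)
  have vC: "v \<in> C" "w1 \<in> N v" using e by (auto simp: edge_def vw)
  have "card (N v) = 3" using e(3) by (simp add: vw)
  from card_3_member[OF this vC(2)] obtain w2 w3
    where w: "N v = {w1, w2, w3}" "w1 \<noteq> w2" "w1 \<noteq> w3" "w2 \<noteq> w3" by (elim exE conjE)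
  have ed: "edge (v, w2)" "edge (v, w3)" using vC w by (auto simp: edge_def)
  have sum: "ratio e + ratio (v, w2) + ratio (v, w3) = \<rho>" unfolding vw using vC w by (intro ratio_sum_3)
  have e_ge: "1 / t \<le> ratio e" unfolding t_def using fork_ratio_ge e \<rho> by blast
  \<comment> \<open>Multiplied out with t \<rho> = t^2 + 1 this is t^4 < t^2 + 1.\<close>
  have two: "\<rho> < 2 / t + 1 / \<rho>"
  proof -
    have "t\<^sup>2 * (t\<^sup>2 - 1) < 1" using t(3) by (simp add: algebra_simps flip: power_add)
    moreover have "t * \<rho> = t\<^sup>2 + 1" using t by (simp add: distrib_left power2_eq_square)
    have "(t\<^sup>2 - 1) * (t * \<rho>) < t * t"
      unfolding \<open>t * \<rho> = t\<^sup>2 + 1\<close> using t(3) by (simp add: algebra_simps power2_eq_square power4_eq_xxxx)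
    then have "t * ((t\<^sup>2 - 1) * \<rho>) < t * t" by (simp add: mult_ac)
    then have "(t\<^sup>2 - 1) * \<rho> < t" using t by (simp only: mult_less_cancel_left_pos)
    then have "(t - 1 / t) * \<rho> < 1" using t(1) by (simp add: field_simps power2_eq_square)
    then have "t - 1 / t < 1 / \<rho>" using \<rho> by (simp add: pos_less_divide_eq)
    then show ?thesis using t(2) by (simp add: field_simps)
  qed
  have arms: "\<not> fork (v, w2)" "\<not> fork (v, w3)"
    using fork_ratio_ge[OF _ ed(1) \<rho>(1)] fork_ratio_ge[OF _ ed(2) \<rho>(1)]
      ratio_ge[OF ed(1)] ratio_ge[OF ed(2)] sum e_ge two \<rho> by (auto simp: t_def)
  from arm_or_fork[OF \<rho> ed(1) arms(1)] obtain i where i: "i \<ge> 1" "ratio (v, w2) = arm i \<rho>"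
    by (elim exE conjE)
  from arm_or_fork[OF \<rho> ed(2) arms(2)] obtain j where j: "j \<ge> 1" "ratio (v, w3) = arm j \<rho>"
    by (elim exE conjE)
  have "i = 1 \<or> j = 1"
  proof (rule ccontr)
    assume "\<not> ?thesis"
    then have "arm 2 \<rho> \<le> arm i \<rho>" "arm 2 \<rho> \<le> arm j \<rho>" using i j \<rho> by (auto intro!: arm_mono_index)
    then have "1 / t + 2 * arm 2 \<rho> \<le> \<rho>" using sum i j e_ge by linarith
    then have "2 * arm 2 \<rho> \<le> t" using t(2) by linarith
    then show False using two_arms_2[OF \<rho>] by (simp add: arm_2[OF \<rho>(1)] t_def)
  qed
  then have "\<exists>b\<ge>1. ratio (v, w2) + ratio (v, w3) = 1 / \<rho> + arm b \<rho>"
  proof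
    assume "i = 1"
    then show ?thesis using i j by (intro exI[of _ j]) (simp add: arm_1)
  next
    assume "j = 1"
    then show ?thesis using i j by (intro exI[of _ i]) (simp add: arm_1)
  qed
  then obtain b where b: "b \<ge> 1" "ratio (v, w2) + ratio (v, w3) = 1 / \<rho> + arm b \<rho>"
    by (elim exE conjE)
  then have "ratio e = branch b \<rho>" using sum by (simp add: branch_def)
  then show ?thesis using b e_ge by (intro exI[of _ b]) (auto simp: margin_branch t_def)
qed

text \<open>From a branch vertex, either all three edges begin arms, which gives a star, or some
  path runs into a branch vertex; then \<open>fork_at_branch_vertex\<close> applies at both ends of
  that path.\<close>

lemma branch_structure:
  assumes \<rho>: "2 < \<rho>" "\<rho> < sqrt (2 + sqrt 5)"
  shows "(\<exists>a b c. star_eq \<rho> a b c) \<or> (\<exists>a b m. double_star_eq \<rho> a b m)"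
proof -
  obtain v where v: "v \<in> C" "3 \<le> card (N v)" using exists_branch_vertex[OF \<rho>(1)] by blast
  then have c3: "card (N v) = 3" using card_le_3[OF \<rho> v(1)] by simp
  show ?thesis
  proof (cases "\<exists>w\<in>N v. fork (v, w)")
    case True
    then obtain w where w: "w \<in> N v" "fork (v, w)" by blast
    then have e: "edge (v, w)" using v by (simp add: edge_def)
    obtain L f where f: "(step ^^ L) (v, w) f" "card (N (snd f)) = 3" using w by (auto simp: fork_def)
    have "card (N (fst (v, w))) = 3" using c3 by simp
    from fork_at_branch_vertex[OF \<rho> e w(2) this]
    obtain a where a: "a \<ge> 1" "0 \<le> margin a \<rho>" "ratio (v, w) = branch a \<rho>" by (elim exE conjE)
    have ef: "edge f" using f e steps_edge by blast
    have "fork (prod.swap f)"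
      unfolding fork_def using steps_swap[OF f(1)] c3 by (intro exI[of _ L] exI[of _ "prod.swap (v, w)"]) auto
    moreover have "card (N (fst (prod.swap f))) = 3" using f(2) by simp
    ultimately have "\<exists>b\<ge>1. 0 \<le> margin b \<rho> \<and> ratio (prod.swap f) = branch b \<rho>"
      by (rule fork_at_branch_vertex[OF \<rho> edge_swap[OF ef]])
    then obtain b where b: "b \<ge> 1" "0 \<le> margin b \<rho>" "ratio (prod.swap f) = branch b \<rho>"
      by (elim exE conjE)
    \<comment> \<open>The ratio propagated to the last edge and the ratio of that edge reversed are
      inverse to each other.\<close>
    have "((\<lambda>q. \<rho> - 1 / q) ^^ L) (branch a \<rho>) * branch b \<rho> = ratio f * (1 / ratio f)"
      using steps_ratio[OF f(1) e] a b by (simp add: ratio_swap)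
    also have "\<dots> = 1" using ratio_pos[OF ef] by simp
    finally have "double_star_eq \<rho> a b L" using a b by (simp add: double_star_eq_def)
    then show ?thesis by blast
  next
    case False
    obtain w1 w2 w3 where w: "N v = {w1, w2, w3}" "w1 \<noteq> w2" "w1 \<noteq> w3" "w2 \<noteq> w3"
      using c3 by (auto simp: card_3_iff)
    have arm: "\<exists>k\<ge>1. ratio (v, w) = arm k \<rho>" if "w \<in> N v" for w
    proof -
      have "edge (v, w)" using that v(1) by (simp add: edge_def)
      moreover have "\<not> fork (v, w)" using False that by blast
      ultimately show ?thesis by (rule arm_or_fork[OF \<rho>])
    qed
    have mem: "w1 \<in> N v" "w2 \<in> N v" "w3 \<in> N v" unfolding w(1) by blast+
    from arm[OF mem(1)] obtain i where i: "i \<ge> 1" "ratio (v, w1) = arm i \<rho>" by (elim exE conjE)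
    from arm[OF mem(2)] obtain j where j: "j \<ge> 1" "ratio (v, w2) = arm j \<rho>" by (elim exE conjE)
    from arm[OF mem(3)] obtain k where k: "k \<ge> 1" "ratio (v, w3) = arm k \<rho>" by (elim exE conjE)
    note ijk = i j k
    then have sum: "\<rho> = arm i \<rho> + arm j \<rho> + arm k \<rho>" using ratio_sum_3[OF v(1) w] by simp
    have le: "1 \<le> i \<and> 1 \<le> j \<and> 1 \<le> k" by (intro conjI i(1) j(1) k(1))
    show ?thesis using star_eq_perm[OF le sum] by (rule disjI1)
  qed
qed

end

section \<open>The Perron eigenvector\<close>

definition nbrs :: "'a pair_pre_digraph \<Rightarrow> 'a \<Rightarrow> 'a set" where
  "nbrs G v = {w. (v, w) \<in> parcs G}"

text \<open>The adjacency operator on functions of the vertices. The codomain is left open because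
  it acts both on complex eigenvectors and on their real moduli.\<close>

definition nbr_sum :: "'a pair_pre_digraph \<Rightarrow> ('a \<Rightarrow> 'b::comm_monoid_add) \<Rightarrow> 'a \<Rightarrow> 'b" where
  "nbr_sum G z v = (\<Sum>w\<in>nbrs G v. z w)"

lemma simple_graphD:
  assumes "simple_graph G"
  shows "finite (pverts G)" "pverts G \<noteq> {}" "nbrs G v \<subseteq> pverts G" "finite (nbrs G v)"
    "w \<in> nbrs G v \<longleftrightarrow> v \<in> nbrs G w"
proof -
  from assms interpret pair_graph G by (simp add: simple_graph_def)
  show fin: "finite (pverts G)" by (rule pair_finite_verts)
  show "pverts G \<noteq> {}" using assms by (simp add: simple_graph_def)
  show sub: "nbrs G v \<subseteq> pverts G" using in_arcsD2 by (auto simp: nbrs_def)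
  show "finite (nbrs G v)" using sub fin by (rule finite_subset)
  show "w \<in> nbrs G v \<longleftrightarrow> v \<in> nbrs G w"
    using pair_sym_arcs by (auto simp: nbrs_def symmetric_def sym_def)
qed

section \<open>From the adjacency matrix to functions on the vertices\<close>

context
  fixes G :: "'a::linorder pair_pre_digraph"
  assumes G: "simple_graph G"
begin

private abbreviation "vs \<equiv> sorted_list_of_set (pverts G)"
private abbreviation "n \<equiv> card (pverts G)"

lemma adjacency_matrix_carrier: "adjacency_matrix G \<in> carrier_mat n n"
  by (simp add: adjacency_matrix_def Let_def)

lemma card_pverts_pos: "n > 0"
  using simple_graphD(1,2)[OF G] by (simp add: card_gt_0_iff)

private lemma bij_vs: "bij_betw (\<lambda>i. vs ! i) {0..<n} (pverts G)"
proof -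
  have "bij_betw ((!) vs) {..<length vs} (set vs)"
    by (rule bij_betw_nth) auto
  then show ?thesis
    using simple_graphD(1)[OF G] by (simp add: atLeast0LessThan)
qed

private definition tovec :: "('a \<Rightarrow> complex) \<Rightarrow> complex vec" where
  "tovec z = vec n (\<lambda>i. z (vs ! i))"

private lemma tovec_surj:
  assumes "x \<in> carrier_vec n"
  obtains z where "x = tovec z"
proof
  show "x = tovec (\<lambda>v. x $ (the_inv_into {0..<n} (\<lambda>i. vs ! i) v))"
  proof (rule eq_vecI)
    fix i assume "i < dim_vec (tovec (\<lambda>v. x $ (the_inv_into {0..<n} (\<lambda>i. vs ! i) v)))"
    then have i: "i < n" by (simp add: tovec_def)
    then have "the_inv_into {0..<n} (\<lambda>i. vs ! i) (vs ! i) = i"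
      using bij_vs by (intro the_inv_into_f_f) (auto simp: bij_betw_def)
    then show "x $ i = tovec (\<lambda>v. x $ (the_inv_into {0..<n} (\<lambda>i. vs ! i) v)) $ i"
      using i by (simp add: tovec_def)
  qed (use assms in \<open>simp add: tovec_def\<close>)
qed

private lemma tovec_eq_iff: "tovec z = tovec z' \<longleftrightarrow> (\<forall>v\<in>pverts G. z v = z' v)"
proof -
  have "tovec z = tovec z' \<longleftrightarrow> (\<forall>i\<in>{0..<n}. z (vs ! i) = z' (vs ! i))"
    by (auto simp: tovec_def vec_eq_iff)
  also have "\<dots> \<longleftrightarrow> (\<forall>v\<in>(\<lambda>i. vs ! i) ` {0..<n}. z v = z' v)" by simp
  also have "(\<lambda>i. vs ! i) ` {0..<n} = pverts G" using bij_vs by (simp add: bij_betw_def)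
  finally show ?thesis .
qed

private lemma adjacency_mult_tovec: "adjacency_matrix G *\<^sub>v tovec z = tovec (nbr_sum G z)"
proof (rule eq_vecI)
  fix i assume "i < dim_vec (tovec (nbr_sum G z))"
  then have i: "i < n" by (simp add: tovec_def)
  have "(adjacency_matrix G *\<^sub>v tovec z) $ i
      = (\<Sum>j\<in>{0..<n}. (if (vs ! i, vs ! j) \<in> parcs G then z (vs ! j) else 0))"
    using i by (auto simp: adjacency_matrix_def Let_def tovec_def scalar_prod_def intro!: sum.cong)
  also have "\<dots> = (\<Sum>w\<in>pverts G. (if (vs ! i, w) \<in> parcs G then z w else 0))"
    by (rule sum.reindex_bij_betw[OF bij_vs])
  also have "\<dots> = (\<Sum>w\<in>pverts G \<inter> {w. (vs ! i, w) \<in> parcs G}. z w)"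
    using simple_graphD(1)[OF G] by (simp add: sum.inter_restrict)
  also have "pverts G \<inter> {w. (vs ! i, w) \<in> parcs G} = nbrs G (vs ! i)"
    using simple_graphD(3)[OF G] by (auto simp: nbrs_def)
  finally show "(adjacency_matrix G *\<^sub>v tovec z) $ i = tovec (nbr_sum G z) $ i"
    using i by (simp add: tovec_def nbr_sum_def)
qed (simp add: tovec_def adjacency_matrix_def Let_def)

lemma eigenvalue_adjacency_matrix:
  "eigenvalue (adjacency_matrix G) \<mu> \<longleftrightarrow>
    (\<exists>z. (\<exists>v\<in>pverts G. z v \<noteq> 0) \<and> (\<forall>v\<in>pverts G. nbr_sum G z v = \<mu> * z v))"
proof -
  have "eigenvalue (adjacency_matrix G) \<mu> \<longleftrightarrow>
      (\<exists>x\<in>carrier_vec n. x \<noteq> 0\<^sub>v n \<and> adjacency_matrix G *\<^sub>v x = \<mu> \<cdot>\<^sub>v x)"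
    using carrier_matD(1)[OF adjacency_matrix_carrier] by (auto simp only: eigenvalue_def eigenvector_def)
  also have "\<dots> \<longleftrightarrow> (\<exists>z. tovec z \<noteq> tovec (\<lambda>_. 0) \<and> tovec (nbr_sum G z) = tovec (\<lambda>v. \<mu> * z v))"
  proof -
    have "tovec z \<in> carrier_vec n" "tovec (\<lambda>_. 0) = 0\<^sub>v n" "\<mu> \<cdot>\<^sub>v tovec z = tovec (\<lambda>v. \<mu> * z v)" for z
      by (auto simp: tovec_def vec_eq_iff)
    note tv = this
    show ?thesis
    proof
      assume "\<exists>x\<in>carrier_vec n. x \<noteq> 0\<^sub>v n \<and> adjacency_matrix G *\<^sub>v x = \<mu> \<cdot>\<^sub>v x"
      then obtain x where x: "x \<in> carrier_vec n" "x \<noteq> 0\<^sub>v n" "adjacency_matrix G *\<^sub>v x = \<mu> \<cdot>\<^sub>v x" by blast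
      from x(1) obtain z where "x = tovec z" by (rule tovec_surj)
      then show "\<exists>z. tovec z \<noteq> tovec (\<lambda>_. 0) \<and> tovec (nbr_sum G z) = tovec (\<lambda>v. \<mu> * z v)"
        using x tv adjacency_mult_tovec by auto
    next
      assume "\<exists>z. tovec z \<noteq> tovec (\<lambda>_. 0) \<and> tovec (nbr_sum G z) = tovec (\<lambda>v. \<mu> * z v)"
      then obtain z where "tovec z \<noteq> tovec (\<lambda>_. 0)" "tovec (nbr_sum G z) = tovec (\<lambda>v. \<mu> * z v)" by blast
      then show "\<exists>x\<in>carrier_vec n. x \<noteq> 0\<^sub>v n \<and> adjacency_matrix G *\<^sub>v x = \<mu> \<cdot>\<^sub>v x"
        using tv adjacency_mult_tovec by (intro bexI[of _ "tovec z"]) auto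
    qed
  qed
  finally show ?thesis by (simp add: tovec_eq_iff)
qed

lemma rho_A_attained: "\<exists>\<mu>. eigenvalue (adjacency_matrix G) \<mu> \<and> norm \<mu> = rho_A G"
  using spectral_radius_mem_max(1)[OF adjacency_matrix_carrier card_pverts_pos]
  by (auto simp: rho_A_def spectrum_def)

lemma norm_eigenvalue_le_rho_A:
  "eigenvalue (adjacency_matrix G) \<mu> \<Longrightarrow> norm \<mu> \<le> rho_A G"
  using spectral_radius_mem_max(2)[OF adjacency_matrix_carrier card_pverts_pos, of "norm \<mu>"]
  by (auto simp: rho_A_def spectrum_def)

text \<open>Take an eigenvector z for an eigenvalue of maximal modulus and a vertex where |z| / y is
  largest: there the triangle inequality gives \<open>rho_A G\<close> <= l. Conversely y itself
  shows that l is an eigenvalue.\<close>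

lemma rho_A_eqI:
  fixes y :: "'a \<Rightarrow> real"
  assumes pos: "\<And>v. v \<in> pverts G \<Longrightarrow> y v > 0"
    and eig: "\<And>v. v \<in> pverts G \<Longrightarrow> nbr_sum G y v = l * y v"
  shows "rho_A G = l"
proof (rule antisym)
  obtain u where u: "u \<in> pverts G" using simple_graphD(2)[OF G] by blast
  have l0: "l \<ge> 0"
  proof -
    have "nbr_sum G y u \<ge> 0" unfolding nbr_sum_def
      by (intro sum_nonneg less_imp_le pos) (use simple_graphD(3)[OF G] in blast)
    then have "\<not> l * y u < 0" using eig[OF u] by linarith
    then show ?thesis using mult_neg_pos[OF _ pos[OF u]] by force
  qed
  have "nbr_sum G (\<lambda>v. complex_of_real (y v)) v = of_real l * of_real (y v)" if "v \<in> pverts G" for v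
    using eig[OF that] unfolding nbr_sum_def of_real_sum[symmetric] by simp
  moreover have "complex_of_real (y u) \<noteq> 0" using pos[OF u] by simp
  ultimately have "eigenvalue (adjacency_matrix G) (of_real l)"
    using u by (intro iffD2[OF eigenvalue_adjacency_matrix] exI[of _ "\<lambda>v. complex_of_real (y v)"]) auto
  from norm_eigenvalue_le_rho_A[OF this] show "l \<le> rho_A G" using l0 by simp
  from rho_A_attained obtain \<mu> where "eigenvalue (adjacency_matrix G) \<mu>" and mu: "norm \<mu> = rho_A G"
    by (elim exE conjE)
  then obtain z where z0: "\<exists>v\<in>pverts G. z v \<noteq> 0"
    and z: "\<And>v. v \<in> pverts G \<Longrightarrow> nbr_sum G z v = \<mu> * z v"
    unfolding eigenvalue_adjacency_matrix by blast
  define c where "c = Max ((\<lambda>v. norm (z v) / y v) ` pverts G)"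
  have fin: "finite ((\<lambda>v. norm (z v) / y v) ` pverts G)" using simple_graphD(1)[OF G] by simp
  have "c \<in> (\<lambda>v. norm (z v) / y v) ` pverts G"
    unfolding c_def using fin simple_graphD(2)[OF G] by (intro Max_in) auto
  then obtain v where v: "v \<in> pverts G" "c = norm (z v) / y v" by blast
  have le: "norm (z w) \<le> c * y w" if "w \<in> pverts G" for w
  proof -
    have "norm (z w) / y w \<le> c" unfolding c_def using fin that by (intro Max_ge) auto
    then show ?thesis using pos[OF that] by (simp add: field_simps)
  qed
  have cpos: "c > 0"
  proof -
    obtain w where w: "w \<in> pverts G" "z w \<noteq> 0" using z0 by blast
    have "0 < norm (z w)" using w by simp
    then have "0 < c * y w" using le[OF w(1)] by linarith
    then show ?thesis using pos[OF w(1)] by (simp add: zero_less_mult_iff)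
  qed
  have "rho_A G * (c * y v) = norm (nbr_sum G z v)"
    using z[OF v(1)] mu v pos[OF v(1)] by (simp add: norm_mult)
  also have "\<dots> \<le> (\<Sum>w\<in>nbrs G v. c * y w)" unfolding nbr_sum_def
    by (intro sum_norm_le le) (use simple_graphD(3)[OF G] in blast)
  also have "\<dots> = c * nbr_sum G y v" unfolding nbr_sum_def by (rule sum_distrib_left[symmetric])
  also have "\<dots> = l * (c * y v)" using eig[OF v(1)] by simp
  finally show "rho_A G \<le> l" using cpos pos[OF v(1)] by simp
qed

text \<open>Scaled by 1 / r the matrix has spectral radius below 1, so the entries of its powers are
  uniformly bounded.\<close>

private lemma growth_bound:
  fixes x :: "'a \<Rightarrow> real"
  assumes r: "rho_A G < r"
  obtains c where "c > 0" "\<And>k v. v \<in> pverts G \<Longrightarrow> \<bar>(nbr_sum G ^^ k) x v\<bar> \<le> c * r ^ k"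
proof -
  from rho_A_attained obtain \<mu> :: complex where "norm \<mu> = rho_A G" by (elim exE conjE)
  then have r0: "r > 0" using r by (smt (verit) norm_ge_zero)
  define B where "B = complex_of_real (1 / r) \<cdot>\<^sub>m adjacency_matrix G"
  have B: "B \<in> carrier_mat n n" by (simp add: B_def adjacency_matrix_carrier)
  have B_mult: "B *\<^sub>v x = of_real (1 / r) \<cdot>\<^sub>v (adjacency_matrix G *\<^sub>v x)" if "x \<in> carrier_vec n" for x
    using that carrier_matD[OF adjacency_matrix_carrier]
    by (intro eq_vecI) (simp_all add: B_def scalar_prod_def sum_distrib_left mult.assoc)
  have "spectral_radius B < 1"
  proof -
    obtain \<nu> where nu: "eigenvalue B \<nu>" "spectral_radius B = norm \<nu>"
      using spectral_radius_mem_max(1)[OF B card_pverts_pos] by (auto simp: spectrum_def)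
    then obtain x where x: "x \<in> carrier_vec n" "x \<noteq> 0\<^sub>v n" "B *\<^sub>v x = \<nu> \<cdot>\<^sub>v x"
      using B by (auto simp: eigenvalue_def eigenvector_def)
    have "adjacency_matrix G *\<^sub>v x = of_real r \<cdot>\<^sub>v (B *\<^sub>v x)"
      using r0 x(1) by (intro eq_vecI) (simp_all add: B_mult)
    also have "\<dots> = (of_real r * \<nu>) \<cdot>\<^sub>v x" using x by (simp add: smult_smult_assoc)
    finally have "eigenvalue (adjacency_matrix G) (of_real r * \<nu>)"
      using x carrier_matD(1)[OF adjacency_matrix_carrier] by (auto simp only: eigenvalue_def eigenvector_def)
    then have "norm (of_real r * \<nu>) \<le> rho_A G" by (rule norm_eigenvalue_le_rho_A)
    then have "r * norm \<nu> < r * 1" using r r0 by (simp only: norm_mult norm_of_real)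
    then show ?thesis using nu r0 by (simp only: mult_less_cancel_left_pos)
  qed
  from spectral_radius_jnf_norm_bound_less_1_upper_triangular[OF B this]
  obtain c where c: "norm_bound (B ^\<^sub>m k) c" for k by blast
  have pow: "(B ^\<^sub>m k) *\<^sub>v tovec (\<lambda>v. of_real (x v)) = tovec (\<lambda>v. of_real ((nbr_sum G ^^ k) x v / r ^ k))" for k
  proof (induction k arbitrary: x)
    case 0
    then show ?case using B by (simp add: tovec_def)
  next
    case (Suc k)
    have "B ^\<^sub>m Suc k *\<^sub>v tovec (\<lambda>v. of_real (x v)) = B ^\<^sub>m k *\<^sub>v (B *\<^sub>v tovec (\<lambda>v. of_real (x v)))"
      unfolding pow_mat.simps using B by (intro assoc_mult_mat_vec[of _ n n _ n]) (auto simp: tovec_def)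
    also have "B *\<^sub>v tovec (\<lambda>v. of_real (x v)) = of_real (1 / r) \<cdot>\<^sub>v (adjacency_matrix G *\<^sub>v tovec (\<lambda>v. of_real (x v)))"
      by (intro B_mult) (simp add: tovec_def)
    also have "\<dots> = tovec (\<lambda>v. of_real (nbr_sum G x v / r))"
      unfolding adjacency_mult_tovec
      by (auto simp: tovec_def vec_eq_iff nbr_sum_def sum_divide_distrib)
    also have "B ^\<^sub>m k *\<^sub>v \<dots> = tovec (\<lambda>v. of_real ((nbr_sum G ^^ k) (\<lambda>v. nbr_sum G x v / r) v / r ^ k))"
      by (rule Suc.IH)
    also have "(nbr_sum G ^^ k) (\<lambda>v. nbr_sum G x v / r) = (\<lambda>v. (nbr_sum G ^^ k) (nbr_sum G x) v / r)"
      by (induction k) (auto simp: nbr_sum_def sum_divide_distrib)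
    finally show ?case by (simp add: funpow_swap1 field_simps)
  qed
  define d where "d = (\<Sum>j\<in>{0..<n}. c * \<bar>x (vs ! j)\<bar>)"
  have bd: "\<bar>(nbr_sum G ^^ k) x v\<bar> \<le> d * r ^ k" if v: "v \<in> pverts G" for k v
  proof -
    have "v \<in> (\<lambda>i. vs ! i) ` {0..<n}" using bij_vs v by (simp add: bij_betw_def)
    then obtain i where i: "i < n" "v = vs ! i" by auto
    have Bk: "B ^\<^sub>m k \<in> carrier_mat n n" using B by simp
    have "\<bar>(nbr_sum G ^^ k) x v / r ^ k\<bar> = norm (((B ^\<^sub>m k) *\<^sub>v tovec (\<lambda>v. of_real (x v))) $ i)"
      unfolding pow using i by (simp add: tovec_def norm_divide norm_power power_abs)
    also have "\<dots> = norm (\<Sum>j\<in>{0..<n}. (B ^\<^sub>m k) $$ (i, j) * of_real (x (vs ! j)))"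
      using i carrier_matD[OF Bk] by (simp add: scalar_prod_def tovec_def del: pow_mat_dim)
    also have "\<dots> \<le> d" unfolding d_def
    proof (intro sum_norm_le)
      fix j assume "j \<in> {0..<n}"
      then have "norm ((B ^\<^sub>m k) $$ (i, j)) \<le> c" using c[of k] i carrier_matD[OF Bk] by (simp add: norm_bound_def del: pow_mat_dim)
      then show "norm ((B ^\<^sub>m k) $$ (i, j) * of_real (x (vs ! j))) \<le> c * \<bar>x (vs ! j)\<bar>"
        by (simp add: norm_mult mult_right_mono)
    qed
    finally show ?thesis using r0 by (simp add: field_simps)
  qed
  show ?thesis
  proof
    show "\<bar>d\<bar> + 1 > 0" by simp
    fix k v assume "v \<in> pverts G"
    then have "\<bar>(nbr_sum G ^^ k) x v\<bar> \<le> d * r ^ k" by (rule bd)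
    also have "\<dots> \<le> (\<bar>d\<bar> + 1) * r ^ k" using r0 by (intro mult_right_mono) auto
    finally show "\<bar>(nbr_sum G ^^ k) x v\<bar> \<le> (\<bar>d\<bar> + 1) * r ^ k" .
  qed
qed

lemma sum_nbr_sum_commute:
  fixes x y :: "'a \<Rightarrow> real"
  shows "(\<Sum>v\<in>pverts G. x v * nbr_sum G y v) = (\<Sum>v\<in>pverts G. nbr_sum G x v * y v)"
proof -
  have *: "nbr_sum G z v = (\<Sum>w\<in>pverts G. if (v, w) \<in> parcs G then z w else 0)" for v and z :: "'a \<Rightarrow> real"
  proof -
    have "nbrs G v = pverts G \<inter> {w. (v, w) \<in> parcs G}"
      using simple_graphD(3)[OF G, of v] by (auto simp: nbrs_def)
    then show ?thesis using simple_graphD(1)[OF G] by (simp add: nbr_sum_def sum.inter_restrict)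
  qed
  have sym: "(v, w) \<in> parcs G \<longleftrightarrow> (w, v) \<in> parcs G" for v w
    using simple_graphD(5)[OF G, of w v] by (simp add: nbrs_def)
  have "(\<Sum>v\<in>pverts G. x v * nbr_sum G y v)
      = (\<Sum>v\<in>pverts G. \<Sum>w\<in>pverts G. if (v, w) \<in> parcs G then x v * y w else 0)"
    by (auto simp: * sum_distrib_left intro!: sum.cong)
  also have "\<dots> = (\<Sum>w\<in>pverts G. \<Sum>v\<in>pverts G. if (v, w) \<in> parcs G then x v * y w else 0)"
    by (rule sum.swap)
  also have "\<dots> = (\<Sum>v\<in>pverts G. nbr_sum G x v * y v)"
    by (auto simp: * sum_distrib_right sym intro!: sum.cong)
  finally show ?thesis .
qed

text \<open>For an eigenvector \<open>z\<close> of maximal modulus, \<open>\<bar>z\<bar>\<close> is a nonnegative subsolution. It must be an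
  exact solution: otherwise, by symmetry, \<open>\<parallel>A\<^sup>k \<bar>z\<bar>\<parallel>\<close> would grow faster than the spectral
  radius allows. Its support is then closed under taking neighbours.\<close>

lemma simple_graph_eigen_component: "\<exists>C y. eigen_component (nbrs G) C y (rho_A G)"
proof -
  from rho_A_attained obtain \<mu> where "eigenvalue (adjacency_matrix G) \<mu>" and mu: "norm \<mu> = rho_A G"
    by (elim exE conjE)
  then obtain z where z0: "\<exists>v\<in>pverts G. z v \<noteq> 0"
    and z: "\<And>v. v \<in> pverts G \<Longrightarrow> nbr_sum G z v = \<mu> * z v"
    unfolding eigenvalue_adjacency_matrix by blast
  define \<rho> where "\<rho> = rho_A G"
  have rho0: "\<rho> \<ge> 0" using mu by (simp add: \<rho>_def flip: mu)
  define x where "x = (\<lambda>v. norm (z v))"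
  have sub: "\<rho> * x v \<le> nbr_sum G x v" if "v \<in> pverts G" for v
  proof -
    have "\<rho> * x v = norm (nbr_sum G z v)" using z[OF that] mu by (simp add: norm_mult \<rho>_def x_def)
    also have "\<dots> \<le> nbr_sum G x v" unfolding nbr_sum_def x_def by (rule norm_sum)
    finally show ?thesis .
  qed
  have eq: "nbr_sum G x v = \<rho> * x v" if "v \<in> pverts G" for v
  proof (rule ccontr)
    assume "nbr_sum G x v \<noteq> \<rho> * x v"
    then have lt: "\<rho> * x v < nbr_sum G x v" using sub[OF that] by simp
    define T where "T = (\<lambda>k. (nbr_sum G ^^ k) x)"
    define b where "b = (\<lambda>k. \<Sum>v\<in>pverts G. (T k v)\<^sup>2)"
    note fin = simple_graphD(1)[OF G]
    have x0: "x v \<ge> 0" for v by (simp add: x_def)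
    have b0: "b 0 > 0"
    proof -
      obtain w where w: "w \<in> pverts G" "z w \<noteq> 0" using z0 by blast
      have "0 < (x w)\<^sup>2" using w by (simp add: x_def)
      also have "\<dots> \<le> b 0" unfolding b_def T_def using w fin
        by (simp add: member_le_sum[of w _ "\<lambda>v. (x v)\<^sup>2"])
      finally show ?thesis .
    qed
    have b1: "b 1 > \<rho>\<^sup>2 * b 0"
    proof -
      have "(\<Sum>v\<in>pverts G. (\<rho> * x v)\<^sup>2) < (\<Sum>v\<in>pverts G. (nbr_sum G x v)\<^sup>2)"
      proof (rule sum_strict_mono_ex1[OF fin])
        show "\<forall>v\<in>pverts G. (\<rho> * x v)\<^sup>2 \<le> (nbr_sum G x v)\<^sup>2"
          using sub x0 rho0 by (intro ballI power_mono) auto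
        show "\<exists>v\<in>pverts G. (\<rho> * x v)\<^sup>2 < (nbr_sum G x v)\<^sup>2"
          using lt x0 rho0 that by (intro bexI[of _ v] power_strict_mono) auto
      qed
      then show ?thesis by (simp add: b_def T_def power_mult_distrib sum_distrib_left)
    qed
    define q where "q = b 1 / b 0"
    have q: "q > \<rho>\<^sup>2" using b1 b0 by (simp add: q_def field_simps)
    have q0: "q > 0" using q by (smt (verit) zero_le_power2)
    \<comment> \<open>By self-adjointness and Cauchy-Schwarz the squared norms b are log-convex, so
      their successive quotients never fall below the first one, q > \<rho>^2.\<close>
    have step: "b (Suc k) \<ge> q * b k \<and> b k > 0" for k
    proof (induction k)
      case 0
      then show ?case using b0 by (simp add: q_def)
    next
      case (Suc k)
      have pos: "b (Suc k) > 0" using Suc q0 by (smt (verit) mult_pos_pos)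
      have "b (Suc k) = (\<Sum>v\<in>pverts G. T k v * T (Suc (Suc k)) v)"
        using sum_nbr_sum_commute[of "T k" "T (Suc k)"] by (simp add: b_def T_def power2_eq_square)
      then have "(b (Suc k))\<^sup>2 \<le> b k * b (Suc (Suc k))"
        unfolding b_def by (simp only: Cauchy_Schwarz_ineq_sum)
      moreover have "b (Suc k) * (q * b k) \<le> (b (Suc k))\<^sup>2"
        using Suc pos by (simp add: power2_eq_square)
      ultimately have "b k * (q * b (Suc k)) \<le> b k * b (Suc (Suc k))" by (simp add: mult_ac)
      then show ?case using Suc pos by simp
    qed
    have lower: "q ^ k * b 0 \<le> b k" for k
    proof (induction k)
      case (Suc k)
      have "q ^ Suc k * b 0 \<le> q * b k" using Suc q0 by (simp add: mult_ac)
      then show ?case using step[of k] by linarith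
    qed simp
    \<comment> \<open>With r between \<rho> and sqrt q, \<open>growth_bound\<close> allows b at most
      a constant times r^(2k), while the lower bound demands a constant times q^k.\<close>
    obtain r where r: "\<rho> < r" "r\<^sup>2 < q"
    proof
      have *: "\<rho> < sqrt q" using q rho0 by (simp add: real_less_rsqrt)
      then show "\<rho> < (\<rho> + sqrt q) / 2" by simp
      have "((\<rho> + sqrt q) / 2)\<^sup>2 < (sqrt q)\<^sup>2" using * rho0 by (intro power_strict_mono) auto
      then show "((\<rho> + sqrt q) / 2)\<^sup>2 < q" using q0 by simp
    qed
    obtain c where c: "c > 0" "\<And>k v. v \<in> pverts G \<Longrightarrow> \<bar>T k v\<bar> \<le> c * r ^ k"
      using growth_bound[of r x] r(1) unfolding T_def \<rho>_def by blast
    have upper: "b k \<le> real n * (c\<^sup>2 * (r\<^sup>2) ^ k)" for k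
    proof -
      have "b k \<le> (\<Sum>v\<in>pverts G. (c * r ^ k)\<^sup>2)" unfolding b_def
      proof (rule sum_mono)
        fix v assume "v \<in> pverts G"
        then have "\<bar>T k v\<bar>\<^sup>2 \<le> (c * r ^ k)\<^sup>2" by (intro power_mono c) auto
        then show "(T k v)\<^sup>2 \<le> (c * r ^ k)\<^sup>2" by simp
      qed
      then show ?thesis by (simp add: power_mult_distrib power_even_eq power_commutes flip: power_mult)
    qed
    have r0: "r > 0" using r rho0 by simp
    obtain k where k: "real n * c\<^sup>2 / b 0 < (q / r\<^sup>2) ^ k"
      using real_arch_pow[of "q / r\<^sup>2" "real n * c\<^sup>2 / b 0"] r r0 by auto
    have "real n * (c\<^sup>2 * (r\<^sup>2) ^ k) < q ^ k * b 0"
      using k b0 r0 by (simp add: field_simps power_divide)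
    then show False using lower[of k] upper[of k] by linarith
  qed
  define C where "C = {v \<in> pverts G. z v \<noteq> 0}"
  have "eigen_component (nbrs G) C x (rho_A G)"
  proof
    show "finite C" using simple_graphD(1)[OF G] by (simp add: C_def)
    show "C \<noteq> {}" using z0 by (auto simp: C_def)
    show "w \<in> nbrs G v \<longleftrightarrow> v \<in> nbrs G w" for v w by (rule simple_graphD(5)[OF G])
    show "x v > 0" if "v \<in> C" for v using that by (simp add: C_def x_def)
    show "(\<Sum>w\<in>nbrs G v. x w) = rho_A G * x v" if "v \<in> C" for v
      using eq[of v] that by (simp add: C_def nbr_sum_def \<rho>_def)
    show "nbrs G v \<subseteq> C" if v: "v \<in> C" for v
    proof
      fix w assume w: "w \<in> nbrs G v"
      then have wV: "w \<in> pverts G" using simple_graphD(3)[OF G] by blast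
      \<comment> \<open>Where x vanishes, the nonnegative values at the neighbours sum to zero, so
        they vanish as well, including the one at v.\<close>
      have "z w \<noteq> 0"
      proof
        assume "z w = 0"
        then have "(\<Sum>u\<in>nbrs G w. x u) = 0" using eq[OF wV] by (simp add: nbr_sum_def x_def)
        then have "\<forall>u\<in>nbrs G w. x u = 0"
          using simple_graphD(4)[OF G] by (simp add: sum_nonneg_eq_0_iff x_def)
        moreover have "v \<in> nbrs G w" using w simple_graphD(5)[OF G] by blast
        ultimately show False using v by (simp add: x_def C_def)
      qed
      then show "w \<in> C" using wV by (simp add: C_def)
    qed
  qed
  then show ?thesis by blast
qed

end

section \<open>Small spectral radii\<close>

context eigen_component
begin

text \<open>Along a walk without backtracking the ratio of consecutive values drops by at least
  \<open>2 - \<rho>\<close> in each step.\<close>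

lemma walk_bounded:
  assumes \<epsilon>: "0 < \<epsilon>" "\<rho> \<le> 2 - \<epsilon>"
    and walk: "\<And>j. j \<le> i \<Longrightarrow> p j \<in> C" "\<And>j. j < i \<Longrightarrow> p (Suc j) \<in> N (p j)"
    and nonback: "\<And>j. Suc (Suc j) \<le> i \<Longrightarrow> p (Suc (Suc j)) \<noteq> p j"
  shows "real i * \<epsilon> \<le> 4"
proof (cases i)
  case (Suc m)
  define q where "q = (\<lambda>j. y (p (Suc j)) / y (p j))"
  have yp: "0 < y (p j)" if "j \<le> i" for j using walk that pos by blast
  have qpos: "0 < q j" if "j < i" for j using yp[of j] yp[of "Suc j"] that by (simp add: q_def)
  have q_le: "q j \<le> 2 - (real j + 1) * \<epsilon>" if "j < i" for j
    using that
  proof (induction j)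
    case 0
    have "y (p 1) \<le> \<rho> * y (p 0)"
      using sum_subset_le[of "p 0" "{p 1}"] walk(1)[of 0] walk(2)[of 0] 0 by simp
    then have "q 0 \<le> \<rho>" using yp[of 0] 0 by (simp add: q_def pos_divide_le_eq)
    then show ?case using \<epsilon> by simp
  next
    case (Suc j)
    have "p j \<in> N (p (Suc j))" using walk(2)[of j] Suc.prems sym by simp
    then have "(\<Sum>w\<in>{p j, p (Suc (Suc j))}. y w) \<le> \<rho> * y (p (Suc j))"
      using Suc.prems by (intro sum_subset_le walk) (auto intro: walk(2))
    then have "y (p j) + y (p (Suc (Suc j))) \<le> \<rho> * y (p (Suc j))"
      using nonback[of j] Suc.prems by simp
    then have "(y (p j) + y (p (Suc (Suc j)))) / y (p (Suc j)) \<le> \<rho>"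
      using yp[of "Suc j"] Suc.prems by (simp add: pos_divide_le_eq)
    then have 1: "1 / q j + q (Suc j) \<le> \<rho>" by (simp add: q_def add_divide_distrib)
    have qj: "0 < q j" using qpos Suc.prems by simp
    \<comment> \<open>This is q + 1 / q >= 2, which turns the eigenvalue equation into a drop by
      \<epsilon>.\<close>
    have "0 \<le> (q j - 1)\<^sup>2 / q j" using qj by simp
    also have "(q j - 1)\<^sup>2 / q j = q j + 1 / q j - 2"
      using qj by (simp add: power2_eq_square field_simps)
    finally have "q (Suc j) \<le> q j - \<epsilon>" using 1 \<epsilon> by linarith
    moreover have "q j \<le> 2 - (real j + 1) * \<epsilon>" using Suc by simp
    ultimately show ?case by (simp add: algebra_simps)
  qed
  have "0 < 2 - (real m + 1) * \<epsilon>" using qpos[of m] q_le[of m] Suc by linarith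
  then show ?thesis using Suc by (simp add: algebra_simps)
qed simp

definition reach :: "'a \<Rightarrow> 'a set" where
  "reach u = {w. (\<lambda>v w. w \<in> N v)\<^sup>*\<^sup>* u w}"

lemma reach_closed: "v \<in> reach u \<Longrightarrow> N v \<subseteq> reach u"
  by (auto simp: reach_def intro: rtranclp.rtrancl_into_rtrancl)

lemma reach_subset: "u \<in> C \<Longrightarrow> reach u \<subseteq> C"
proof
  fix w assume "w \<in> reach u" "u \<in> C"
  then have "(\<lambda>v w. w \<in> N v)\<^sup>*\<^sup>* u w" by (simp add: reach_def)
  then show "w \<in> C" by induction (use \<open>u \<in> C\<close> closed in auto)
qed

text \<open>The component of a single vertex inherits the eigenvector; unlike the whole of
  \<open>C\<close>, it has bounded size when \<rho> <= 2 - \<epsilon>.\<close>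

lemma eigen_component_reach: "u \<in> C \<Longrightarrow> eigen_component N (reach u) y \<rho>"
proof
  assume u: "u \<in> C"
  note sub = reach_subset[OF u]
  show "finite (reach u)" using sub finite_C by (rule finite_subset)
  show "reach u \<noteq> {}" by (auto simp: reach_def)
  show "N v \<subseteq> reach u" if "v \<in> reach u" for v using that by (rule reach_closed)
  show "w \<in> N v \<longleftrightarrow> v \<in> N w" for v w by (rule sym)
  show "0 < y v" if "v \<in> reach u" for v using that sub pos by blast
  show "(\<Sum>w\<in>N v. y w) = \<rho> * y v" if "v \<in> reach u" for v using that sub eig by blast
qed

text \<open>For positive \<rho> this is \<open>card_le_square\<close>; for \<rho> <= 0 a positive
  vector admits no neighbours at all.\<close>

lemma card_N_le_4:
  assumes "\<rho> \<le> 2" "v \<in> C"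
  shows "card (N v) \<le> 4"
proof (cases "0 < \<rho>")
  case True
  have "\<rho>\<^sup>2 \<le> 2\<^sup>2" using True assms by (intro power_mono) auto
  then show ?thesis using card_le_square[OF assms(2) True] by simp
next
  case False
  have "(\<Sum>w\<in>N v. y w) \<le> 0" using eig[OF assms(2)] pos[OF assms(2)] False
    by (simp add: mult_nonpos_nonneg)
  moreover have "0 < (\<Sum>w\<in>N v. y w)" if "N v \<noteq> {}"
    using finite_N[OF assms(2)] that pos closed[OF assms(2)] by (intro sum_pos) auto
  ultimately have "N v = {}" by force
  then show ?thesis by simp
qed

lemma card_sphere:
  assumes "\<rho> \<le> 2" "u \<in> C"
  shows "finite {w. ((\<lambda>v w. w \<in> N v) ^^ i) u w} \<and> card {w. ((\<lambda>v w. w \<in> N v) ^^ i) u w} \<le> 4 ^ i"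
proof (induction i)
  case (Suc i)
  let ?S = "{w. ((\<lambda>v w. w \<in> N v) ^^ i) u w}"
  have S: "?S \<subseteq> C" using reach_subset[OF assms(2)] by (auto simp: reach_def relpowp_imp_rtranclp)
  have eq: "{w. ((\<lambda>v w. w \<in> N v) ^^ Suc i) u w} = (\<Union>v\<in>?S. N v)" by auto
  have "card (\<Union>v\<in>?S. N v) \<le> (\<Sum>v\<in>?S. card (N v))" using Suc by (intro card_UN_le) simp
  also have "\<dots> \<le> (\<Sum>v\<in>?S. 4)" using S by (intro sum_mono card_N_le_4 assms) auto
  also have "\<dots> \<le> 4 ^ Suc i" using Suc by simp
  finally show ?case unfolding eq using Suc finite_N S by auto
qed simp

text \<open>A shortest walk never backtracks, so \<open>walk_bounded\<close> keeps its length below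
  L, and with degrees at most 4 there are at most 4^i ends of walks of length i.\<close>

lemma card_reach_bound:
  assumes \<epsilon>: "0 < \<epsilon>" "\<rho> \<le> 2 - \<epsilon>" and u: "u \<in> C" and L: "4 < real L * \<epsilon>"
  shows "card (reach u) \<le> (\<Sum>i<L. 4 ^ i)"
proof -
  let ?E = "\<lambda>v w. w \<in> N v"
  have "reach u \<subseteq> (\<Union>i<L. {w. (?E ^^ i) u w})"
  proof
    fix w assume w: "w \<in> reach u"
    then have ex: "\<exists>i. (?E ^^ i) u w" by (simp add: reach_def rtranclp_power)
    define i where "i = (LEAST i. (?E ^^ i) u w)"
    have i: "(?E ^^ i) u w" unfolding i_def using ex by (rule LeastI_ex)
    have least: "i \<le> j" if "(?E ^^ j) u w" for j unfolding i_def using that by (rule Least_le)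
    from i obtain p where p: "p 0 = u" "p i = w" "\<And>j. j < i \<Longrightarrow> p (Suc j) \<in> N (p j)"
      unfolding relpowp_fun_conv by blast
    have pC: "p j \<in> C" if "j \<le> i" for j
      using that by (induction j) (use u p closed in \<open>force+\<close>)
    have "real i * \<epsilon> \<le> 4"
    proof (rule walk_bounded[OF \<epsilon>, of i p])
      show "p j \<in> C" if "j \<le> i" for j using that by (rule pC)
      show "p (Suc j) \<in> N (p j)" if "j < i" for j using that by (rule p(3))
      fix j assume j: "Suc (Suc j) \<le> i"
      show "p (Suc (Suc j)) \<noteq> p j"
      proof
        assume eq: "p (Suc (Suc j)) = p j"
        \<comment> \<open>The walk with the detour from position j to j + 2 cut out, two steps
          shorter.\<close>
        define p' where "p' = (\<lambda>k. if k \<le> j then p k else p (k + 2))"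
        have "p' 0 = u" using p by (simp add: p'_def)
        moreover have "p' (i - 2) = w"
        proof (cases "i - 2 \<le> j")
          case True
          then have "i = Suc (Suc j)" using j by simp
          then show ?thesis using eq p by (simp add: p'_def)
        next
          case False
          moreover have "Suc (Suc (i - 2)) = i" using j by simp
          ultimately show ?thesis using p(2) by (simp add: p'_def)
        qed
        moreover have "p' (Suc k) \<in> N (p' k)" if "k < i - 2" for k
        proof -
          consider "k < j" | "k = j" | "k > j" by linarith
          then show ?thesis
          proof cases
            case 1
            then show ?thesis using p(3)[of k] that by (simp add: p'_def)
          next
            case 2
            then show ?thesis using p(3)[of "Suc (Suc j)"] that eq by (simp add: p'_def)
          next
            case 3
            then show ?thesis using p(3)[of "k + 2"] that by (simp add: p'_def)
          qed
        qed
        ultimately have "(?E ^^ (i - 2)) u w" unfolding relpowp_fun_conv by blast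
        then have "i \<le> i - 2" by (rule least)
        then show False using j by simp
      qed
    qed
    then have "real i * \<epsilon> < real L * \<epsilon>" using L by simp
    then have "i < L" using \<epsilon> by simp
    then show "w \<in> (\<Union>i<L. {w. (?E ^^ i) u w})" using i by blast
  qed
  then have "card (reach u) \<le> card (\<Union>i<L. {w. (?E ^^ i) u w})"
    using card_sphere[OF _ u] \<epsilon> by (intro card_mono) auto
  also have "\<dots> \<le> (\<Sum>i<L. card {w. (?E ^^ i) u w})" by (intro card_UN_le) simp
  also have "\<dots> \<le> (\<Sum>i<L. 4 ^ i)" using card_sphere[OF _ u] \<epsilon> by (intro sum_mono) auto
  finally show ?thesis .
qed

end

section \<open>Finitely many radii from components of bounded size\<close>

lemma positive_eigenvalue_unique:
  fixes z z' :: "nat \<Rightarrow> real"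
  assumes "0 < n" and sym: "\<And>i j. (i, j) \<in> E \<longleftrightarrow> (j, i) \<in> E"
    and pos: "\<And>i. i < n \<Longrightarrow> 0 < z i" "\<And>i. i < n \<Longrightarrow> 0 < z' i"
    and eig: "\<And>i. i < n \<Longrightarrow> (\<Sum>j<n. if (i, j) \<in> E then z j else 0) = \<rho> * z i"
      "\<And>i. i < n \<Longrightarrow> (\<Sum>j<n. if (i, j) \<in> E then z' j else 0) = \<rho>' * z' i"
  shows "\<rho> = \<rho>'"
proof -
  \<comment> \<open>The symmetric bilinear form of the graph, evaluated at z and z' in both
    orders.\<close>
  have "\<rho> * (\<Sum>i<n. z i * z' i) = (\<Sum>i<n. z' i * (\<Sum>j<n. if (i, j) \<in> E then z j else 0))"
    by (simp add: eig sum_distrib_left mult_ac)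
  also have "\<dots> = (\<Sum>i<n. \<Sum>j<n. if (i, j) \<in> E then z' i * z j else 0)"
    by (simp add: sum_distrib_left if_distrib cong: if_cong)
  also have "\<dots> = (\<Sum>j<n. \<Sum>i<n. if (i, j) \<in> E then z' i * z j else 0)" by (rule sum.swap)
  also have "\<dots> = (\<Sum>j<n. \<Sum>i<n. if (j, i) \<in> E then z' i * z j else 0)" by (simp only: sym)
  also have "\<dots> = (\<Sum>j<n. z j * (\<Sum>i<n. if (j, i) \<in> E then z' i else 0))"
    by (simp add: sum_distrib_left if_distrib mult.commute cong: if_cong)
  also have "\<dots> = \<rho>' * (\<Sum>i<n. z i * z' i)" by (simp add: eig sum_distrib_left mult_ac)
  finally have "\<rho> * (\<Sum>i<n. z i * z' i) = \<rho>' * (\<Sum>i<n. z i * z' i)" .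
  moreover have "0 < (\<Sum>i<n. z i * z' i)" using assms(1) pos by (intro sum_pos) auto
  ultimately show ?thesis by simp
qed

text \<open>Numbering the vertices of a component by 0, ..., n - 1 leaves finitely many pairs
  \<open>(n, E)\<close> once n is bounded, and each pair determines \<rho>.\<close>

definition coded_eigenvalue :: "nat \<Rightarrow> (nat \<times> nat) set \<Rightarrow> real \<Rightarrow> bool" where
  "coded_eigenvalue n E \<rho> \<longleftrightarrow> 0 < n \<and> (\<forall>i j. (i, j) \<in> E \<longleftrightarrow> (j, i) \<in> E) \<and>
    (\<exists>z. (\<forall>i<n. 0 < z i) \<and> (\<forall>i<n. (\<Sum>j<n. if (i, j) \<in> E then z j else 0) = \<rho> * z i))"

lemma coded_eigenvalue_unique:
  assumes "coded_eigenvalue n E \<rho>" "coded_eigenvalue n E \<rho>'"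
  shows "\<rho> = \<rho>'"
proof -
  from assms(1) obtain z where n: "0 < n" and sym: "\<forall>i j. (i, j) \<in> E \<longleftrightarrow> (j, i) \<in> E" and z: "\<forall>i<n. 0 < z i"
    "\<forall>i<n. (\<Sum>j<n. if (i, j) \<in> E then z j else 0) = \<rho> * z i"
    unfolding coded_eigenvalue_def by (elim exE conjE)
  from assms(2) obtain z' where z': "\<forall>i<n. 0 < z' i"
    "\<forall>i<n. (\<Sum>j<n. if (i, j) \<in> E then z' j else 0) = \<rho>' * z' i"
    unfolding coded_eigenvalue_def by (elim exE conjE)
  show ?thesis
    by (rule positive_eigenvalue_unique[OF n sym[rule_format] z(1)[rule_format] z'(1)[rule_format]
        z(2)[rule_format] z'(2)[rule_format]])
qed

lemma (in eigen_component) exists_code: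
  "\<exists>E. E \<subseteq> {..<card C} \<times> {..<card C} \<and> coded_eigenvalue (card C) E \<rho>"
proof -
  let ?n = "card C"
  obtain h where h: "bij_betw h {..<?n} C"
    using ex_bij_betw_nat_finite[OF finite_C] by (auto simp: atLeast0LessThan)
  define E where "E = {(i, j). i < ?n \<and> j < ?n \<and> h j \<in> N (h i)}"
  have hC: "h i \<in> C" if "i < ?n" for i using h that by (auto simp: bij_betw_def)
  have "(\<Sum>j<?n. if (i, j) \<in> E then y (h j) else 0) = \<rho> * y (h i)" if i: "i < ?n" for i
  proof -
    have "(\<Sum>j<?n. if (i, j) \<in> E then y (h j) else 0) = (\<Sum>j<?n. if h j \<in> N (h i) then y (h j) else 0)"
      using i by (intro sum.cong) (auto simp: E_def)
    also have "\<dots> = (\<Sum>w\<in>C. if w \<in> N (h i) then y w else 0)"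
      using sum.reindex_bij_betw[OF h, of "\<lambda>w. if w \<in> N (h i) then y w else 0"] .
    also have "\<dots> = (\<Sum>w\<in>C \<inter> N (h i). y w)" using finite_C by (simp add: sum.inter_restrict)
    also have "C \<inter> N (h i) = N (h i)" using closed[OF hC[OF i]] by blast
    finally show ?thesis by (simp add: eig[OF hC[OF i]])
  qed
  then have "coded_eigenvalue ?n E \<rho>"
    unfolding coded_eigenvalue_def
    using finite_C nonempty_C hC pos sym
    by (intro conjI exI[of _ "\<lambda>i. y (h i)"]) (auto simp: card_gt_0_iff E_def)
  moreover have "E \<subseteq> {..<?n} \<times> {..<?n}" by (auto simp: E_def)
  ultimately show ?thesis by blast
qed

lemma finite_coded_eigenvalues:
  "finite {\<rho>. \<exists>n\<le>M. \<exists>E\<subseteq>{..<n} \<times> {..<n}. coded_eigenvalue n E \<rho>}"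
proof -
  have "{\<rho>. \<exists>n\<le>M. \<exists>E\<subseteq>{..<n} \<times> {..<n}. coded_eigenvalue n E \<rho>}
      \<subseteq> (\<lambda>(n, E). THE \<rho>. coded_eigenvalue n E \<rho>) ` ({..M} \<times> Pow ({..<M} \<times> {..<M}))"
  proof clarify
    fix \<rho> n E assume *: "n \<le> M" "E \<subseteq> {..<n} \<times> {..<n}" "coded_eigenvalue n E \<rho>"
    then have "(THE \<rho>. coded_eigenvalue n E \<rho>) = \<rho>"
      by (intro the_equality) (auto intro: coded_eigenvalue_unique)
    moreover have "(n, E) \<in> {..M} \<times> Pow ({..<M} \<times> {..<M})" using * by fastforce
    ultimately show "\<rho> \<in> (\<lambda>(n, E). THE \<rho>. coded_eigenvalue n E \<rho>) ` ({..M} \<times> Pow ({..<M} \<times> {..<M}))"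
      by (intro image_eqI[of _ _ "(n, E)"]) auto
  qed
  then show ?thesis by (rule finite_subset) simp
qed

lemma finite_small_spectral_radii:
  assumes "0 < \<epsilon>"
  shows "finite {rho_A G |G :: 'a::linorder pair_pre_digraph. simple_graph G \<and> rho_A G \<le> 2 - \<epsilon>}"
proof -
  obtain L :: nat where L: "4 < real L * \<epsilon>" using reals_Archimedean3[OF assms] by blast
  define M :: nat where "M = (\<Sum>i<L. 4 ^ i)"
  have "{rho_A G |G :: 'a pair_pre_digraph. simple_graph G \<and> rho_A G \<le> 2 - \<epsilon>}
      \<subseteq> {\<rho>. \<exists>n\<le>M. \<exists>E\<subseteq>{..<n} \<times> {..<n}. coded_eigenvalue n E \<rho>}"
  proof clarify
    fix G :: "'a pair_pre_digraph" assume G: "simple_graph G" "rho_A G \<le> 2 - \<epsilon>"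
    from simple_graph_eigen_component[OF G(1)] obtain C y
      where Cy: "eigen_component (nbrs G) C y (rho_A G)" by blast
    interpret C: eigen_component "nbrs G" C y "rho_A G" by (rule Cy)
    obtain u where u: "u \<in> C" using C.nonempty_C by blast
    interpret R: eigen_component "nbrs G" "C.reach u" y "rho_A G" by (rule C.eigen_component_reach[OF u])
    have "card (C.reach u) \<le> M" unfolding M_def using C.card_reach_bound[OF assms G(2) u L] .
    then show "\<exists>n\<le>M. \<exists>E\<subseteq>{..<n} \<times> {..<n}. coded_eigenvalue n E (rho_A G)"
      using R.exists_code by blast
  qed
  then show ?thesis by (rule finite_subset) (rule finite_coded_eigenvalues)
qed

section \<open>Limit points below sqrt (2 + sqrt 5) are numbers \<open>zeta n\<close>\<close>

lemma limit_point_ge_2: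
  assumes "limit_point_rho_A \<gamma>"
  shows "2 \<le> \<gamma>"
proof (rule ccontr)
  assume "\<not> ?thesis"
  then have lt: "\<gamma> < (2 + \<gamma>) / 2" by simp
  from assms obtain G :: "nat \<Rightarrow> nat pair_pre_digraph" where G: "\<And>k. simple_graph (G k)"
    "\<And>i j. i \<noteq> j \<Longrightarrow> rho_A (G i) \<noteq> rho_A (G j)" "(\<lambda>k. rho_A (G k)) \<longlonglongrightarrow> \<gamma>"
    unfolding limit_point_rho_A_def by blast
  \<comment> \<open>Chosen so that 2 - \<epsilon> is the midpoint of \<gamma> and 2.\<close>
  define \<epsilon> where "\<epsilon> = 2 - (2 + \<gamma>) / 2"
  have "\<epsilon> > 0" using \<open>\<not> 2 \<le> \<gamma>\<close> by (simp add: \<epsilon>_def)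
  from finite_small_spectral_radii[OF this, where 'a = nat] have fin:
    "finite {rho_A G |G :: nat pair_pre_digraph. simple_graph G \<and> rho_A G \<le> 2 - \<epsilon>}" .
  have "inj (\<lambda>k. rho_A (G k))" using G(2) by (auto intro: injI)
  from eventually_not_in_finite_fibre[OF this fin] order_tendstoD(2)[OF G(3) lt]
  have "\<forall>\<^sub>F k in sequentially. False"
  proof eventually_elim
    case (elim k)
    then show ?case using G(1) by (auto simp: \<epsilon>_def)
  qed
  then show False by simp
qed

lemma limit_point_is_zeta:
  assumes "limit_point_rho_A \<gamma>" "\<gamma> < sqrt (2 + sqrt 5)"
  shows "\<exists>n\<ge>1. \<gamma> = zeta n"
proof (cases "\<gamma> = 2")
  case True
  then show ?thesis using zeta_1 by (intro exI[of _ 1]) simp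
next
  case False
  then have \<gamma>: "2 < \<gamma>" using limit_point_ge_2[OF assms(1)] by simp
  from assms obtain G :: "nat \<Rightarrow> nat pair_pre_digraph" where G: "\<And>k. simple_graph (G k)"
    "\<And>i j. i \<noteq> j \<Longrightarrow> rho_A (G i) \<noteq> rho_A (G j)" "(\<lambda>k. rho_A (G k)) \<longlonglongrightarrow> \<gamma>"
    unfolding limit_point_rho_A_def by blast
  have "\<forall>\<^sub>F k in sequentially. 2 < rho_A (G k) \<and> rho_A (G k) < sqrt (2 + sqrt 5)"
    using order_tendstoD[OF G(3)] \<gamma> assms(2) by (intro eventually_conj) auto
  then obtain k0 where k0: "\<And>k. k \<ge> k0 \<Longrightarrow> 2 < rho_A (G k) \<and> rho_A (G k) < sqrt (2 + sqrt 5)"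
    by (auto simp: eventually_sequentially)
  define r where "r = (\<lambda>k. rho_A (G (k + k0)))"
  have r: "inj r" "r \<longlonglongrightarrow> \<gamma>" "\<And>k. 2 < r k" "\<And>k. r k < sqrt (2 + sqrt 5)"
  proof -
    show "inj r"
    proof (rule injI)
      fix i j assume "r i = r j"
      then have "i + k0 = j + k0" using G(2)[of "i + k0" "j + k0"] unfolding r_def by blast
      then show "i = j" by simp
    qed
    show "r \<longlonglongrightarrow> \<gamma>" unfolding r_def by (rule LIMSEQ_ignore_initial_segment[OF G(3)])
    show "2 < r k" "r k < sqrt (2 + sqrt 5)" for k using k0[of "k + k0"] by (auto simp: r_def)
  qed
  have cases: "(\<exists>a b c. star_eq (r k) a b c) \<or> (\<exists>a b m. double_star_eq (r k) a b m)" for k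
  proof -
    from simple_graph_eigen_component[OF G(1)] obtain C y
      where Cy: "eigen_component (nbrs (G (k + k0))) C y (r k)" unfolding r_def by blast
    interpret C: eigen_component "nbrs (G (k + k0))" C y "r k" by (rule Cy)
    show ?thesis by (rule C.branch_structure[OF r(3,4)])
  qed
  have sub: "inj (r \<circ> s) \<and> (r \<circ> s) \<longlonglongrightarrow> \<gamma>" if "strict_mono s" for s
    using that r(1,2) by (auto intro: inj_compose strict_mono_imp_inj_on LIMSEQ_subseq_LIMSEQ)
  \<comment> \<open>One of the two shapes occurs for infinitely many k; the limit lemmas apply to
    the corresponding subsequence.\<close>
  define S where "S = {k. \<exists>a b c. star_eq (r k) a b c}"
  show ?thesis
  proof (cases "infinite S")
    case True
    from infinite_enumerate[OF this] obtain s :: "nat \<Rightarrow> nat"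
      where s: "strict_mono s" "\<forall>k. s k \<in> S" by (elim exE conjE)
    show ?thesis
    proof (rule star_limit[OF _ _ \<gamma> assms(2)])
      show "inj (r \<circ> s)" "(r \<circ> s) \<longlonglongrightarrow> \<gamma>" using sub[OF s(1)] by blast+
      show "2 < (r \<circ> s) k" for k using r(3) by simp
      show "\<exists>a b c. star_eq ((r \<circ> s) k) a b c" for k using s(2) by (simp add: S_def)
    qed
  next
    case False
    then have "infinite (- S)" by (simp add: Compl_eq_Diff_UNIV Diff_infinite_finite)
    from infinite_enumerate[OF this] obtain s :: "nat \<Rightarrow> nat"
      where s: "strict_mono s" "\<forall>k. s k \<in> - S" by (elim exE conjE)
    show ?thesis
    proof (rule double_star_limit[OF _ _ \<gamma> assms(2)])
      show "inj (r \<circ> s)" "(r \<circ> s) \<longlonglongrightarrow> \<gamma>" using sub[OF s(1)] by blast+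
      show "2 < (r \<circ> s) k" for k using r(3) by simp
      show "\<exists>a b m. double_star_eq ((r \<circ> s) k) a b m" for k
        using cases[of "s k"] s(2) by (simp add: S_def)
    qed
  qed
qed

section \<open>Paths and stars with three arms\<close>

definition graph_of :: "nat \<Rightarrow> (nat \<Rightarrow> nat \<Rightarrow> bool) \<Rightarrow> nat pair_pre_digraph" where
  "graph_of M adj = \<lparr>pverts = {..<M}, parcs = {(i, j). i < M \<and> j < M \<and> (adj i j \<or> adj j i)}\<rparr>"

lemma simple_graph_of:
  assumes "0 < M" "\<And>i. \<not> adj i i"
  shows "simple_graph (graph_of M adj)"
proof -
  let ?G = "graph_of M adj"
  have "finite (parcs ?G)"
    by (rule finite_subset[of _ "{..<M} \<times> {..<M}"]) (auto simp: graph_of_def)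
  then have "pair_graph ?G"
    by unfold_locales (use assms(2) in \<open>auto simp: graph_of_def symmetric_def sym_def\<close>)
  then show ?thesis using assms(1) by (auto simp: simple_graph_def graph_of_def)
qed

lemma pverts_graph_of: "pverts (graph_of M adj) = {..<M}"
  by (simp add: graph_of_def)

lemma nbr_sum_graph_of:
  assumes "i < M" "finite A" "\<And>j. j \<in> A \<longleftrightarrow> j < M \<and> (adj i j \<or> adj j i)"
  shows "nbr_sum (graph_of M adj) y i = (\<Sum>j\<in>A. y j)"
proof -
  have "nbrs (graph_of M adj) i = A" using assms by (auto simp: nbrs_def graph_of_def)
  then show ?thesis by (simp add: nbr_sum_def)
qed

lemma simple_graph_path: "simple_graph (graph_of (Suc k) (\<lambda>i j. j = Suc i))"
  by (rule simple_graph_of) simp_all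

text \<open>The positive eigenvector is a half-wave of the sine whose zeros lie just outside the k +
  1 vertices, at the fictitious positions -1 and k + 1.\<close>

lemma rho_A_path: "rho_A (graph_of (Suc k) (\<lambda>i j. j = Suc i)) = 2 * cos (pi / real (k + 2))"
proof (rule rho_A_eqI)
  define \<theta> where "\<theta> = pi / real (k + 2)"
  define y where "y = (\<lambda>i. sin (real (Suc i) * \<theta>))"
  show "simple_graph (graph_of (Suc k) (\<lambda>i j. j = Suc i))" by (rule simple_graph_path)
  have \<theta>: "0 < \<theta>" "real (k + 2) * \<theta> = pi" by (simp_all add: \<theta>_def)
  fix i assume "i \<in> pverts (graph_of (Suc k) (\<lambda>i j. j = Suc i))"
  then have i: "i < Suc k" by (simp add: pverts_graph_of)
  have "real (Suc i) * \<theta> < real (k + 2) * \<theta>" using i \<theta>(1) by (intro mult_strict_right_mono) auto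
  then have "real (Suc i) * \<theta> < pi" unfolding \<theta>(2) .
  then show "0 < y i" unfolding y_def using \<theta>(1) by (intro sin_gt_zero mult_pos_pos) auto
  have yk: "y (Suc k) = 0"
    using \<theta>(2) by (simp add: y_def add.commute)
  \<comment> \<open>The term \<open>sin (real i * \<theta>)\<close> is the value at i - 1, and it is
    0 for i = 0, where natural subtraction would fail.\<close>
  have rec: "sin (real i * \<theta>) + y (Suc i) = 2 * cos \<theta> * y i"
  proof -
    have "real i * \<theta> = real (Suc i) * \<theta> - \<theta>" "real (Suc (Suc i)) * \<theta> = real (Suc i) * \<theta> + \<theta>"
      by (simp_all add: algebra_simps)
    then show ?thesis unfolding y_def by (simp only: sin_add sin_diff) (simp add: algebra_simps)
  qed
  let ?A = "(if i = 0 then {} else {i - 1}) \<union> (if i = k then {} else {Suc i})"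
  have "nbr_sum (graph_of (Suc k) (\<lambda>i j. j = Suc i)) y i = (\<Sum>j\<in>?A. y j)"
    using i by (intro nbr_sum_graph_of) auto
  also have "\<dots> = sin (real i * \<theta>) + y (Suc i)"
  proof (cases "i = 0"; cases "i = k")
    assume "i = 0" "i = k"
    then show ?thesis using yk by simp
  next
    assume "i = 0" "i \<noteq> k"
    then show ?thesis by simp
  next
    assume "i \<noteq> 0" "i = k"
    then have "y (i - 1) = sin (real i * \<theta>)" "y (Suc i) = 0" using yk by (auto simp: y_def)
    then show ?thesis using \<open>i \<noteq> 0\<close> \<open>i = k\<close> by simp
  next
    assume "i \<noteq> 0" "i \<noteq> k"
    moreover from this have "y (i - 1) = sin (real i * \<theta>)" by (auto simp: y_def)
    ultimately show ?thesis by simp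
  qed
  finally show "nbr_sum (graph_of (Suc k) (\<lambda>i j. j = Suc i)) y i = 2 * cos (pi / real (k + 2)) * y i"
    unfolding rec by (simp only: \<theta>_def)
qed

lemma limit_point_2: "limit_point_rho_A 2"
proof -
  define G where "G = (\<lambda>k. graph_of (Suc k) (\<lambda>i j. j = Suc i))"
  define \<theta> where "\<theta> = (\<lambda>k. pi / real (k + 2))"
  have \<rho>: "rho_A (G k) = 2 * cos (\<theta> k)" for k unfolding G_def \<theta>_def by (rule rho_A_path)
  have \<theta>_range: "0 \<le> \<theta> k" "\<theta> k \<le> pi" for k
  proof -
    show "0 \<le> \<theta> k" by (simp add: \<theta>_def)
    have "pi / real (k + 2) \<le> pi / 1" by (intro divide_left_mono) auto
    then show "\<theta> k \<le> pi" by (simp add: \<theta>_def)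
  qed
  have \<theta>_inj: "i = j" if "\<theta> i = \<theta> j" for i j
  proof -
    have "pi / \<theta> k = real (k + 2)" for k by (simp add: \<theta>_def)
    then have "real (i + 2) = real (j + 2)" using that by metis
    then show ?thesis by (simp only: of_nat_eq_iff add_right_cancel)
  qed
  have "simple_graph (G k)" for k unfolding G_def by (rule simple_graph_path)
  moreover have "rho_A (G i) \<noteq> rho_A (G j)" if "i \<noteq> j" for i j
  proof
    assume "rho_A (G i) = rho_A (G j)"
    then have "cos (\<theta> i) = cos (\<theta> j)" unfolding \<rho> by linarith
    then have "\<theta> i = \<theta> j" by (rule cos_inj_pi[OF \<theta>_range \<theta>_range])
    then show False using \<theta>_inj that by blast
  qed
  moreover have "(\<lambda>k. rho_A (G k)) \<longlonglongrightarrow> 2"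
  proof -
    have "(\<lambda>k. pi / real k) \<longlonglongrightarrow> 0" by (rule lim_const_over_n)
    then have "\<theta> \<longlonglongrightarrow> 0" unfolding \<theta>_def by (rule LIMSEQ_ignore_initial_segment)
    then have "(\<lambda>k. 2 * cos (\<theta> k)) \<longlonglongrightarrow> 2 * cos 0" by (intro tendsto_intros)
    then show ?thesis unfolding \<rho> by simp
  qed
  ultimately show ?thesis unfolding limit_point_rho_A_def by (intro exI[of _ G]) simp
qed

text \<open>Equal to 2 sinh (j log t): the solution, vanishing at 0, of the eigenvalue recurrence
  along a path, with positions counted from just beyond the leaf.\<close>

definition sinh_pow :: "real \<Rightarrow> nat \<Rightarrow> real" where
  "sinh_pow t j = t ^ j - (1 / t) ^ j"

lemma sinh_pow:
  assumes "t > 1"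
  shows "sinh_pow t 0 = 0" "0 < sinh_pow t (Suc j)"
    "sinh_pow t j + sinh_pow t (Suc (Suc j)) = (t + 1 / t) * sinh_pow t (Suc j)"
    "arm j (t + 1 / t) = sinh_pow t j / sinh_pow t (Suc j)"
proof -
  show 0: "sinh_pow t 0 = 0" by (simp add: sinh_pow_def)
  have pos: "0 < sinh_pow t (Suc j)" for j
  proof -
    have "(1 / t) ^ Suc j < 1" using assms by (intro power_Suc_less_one) auto
    moreover have "1 < t ^ Suc j" using assms by (intro one_less_power) auto
    ultimately show ?thesis unfolding sinh_pow_def by linarith
  qed
  then show "0 < sinh_pow t (Suc j)" .
  have rec: "sinh_pow t j + sinh_pow t (Suc (Suc j)) = (t + 1 / t) * sinh_pow t (Suc j)" for j
  proof -
    have "t * (1 / t) = 1" using assms by simp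
    moreover have "a ^ j - b ^ j + (a ^ Suc (Suc j) - b ^ Suc (Suc j)) = (a + b) * (a ^ Suc j - b ^ Suc j)"
      if "a * b = 1" for a b :: real
    proof -
      have "(a + b) * (a ^ Suc j - b ^ Suc j) = a ^ Suc (Suc j) - b ^ Suc (Suc j) + (a * b) * a ^ j - (a * b) * b ^ j"
        by (simp add: algebra_simps)
      then show ?thesis using that by simp
    qed
    ultimately show ?thesis unfolding sinh_pow_def by blast
  qed
  then show "sinh_pow t j + sinh_pow t (Suc (Suc j)) = (t + 1 / t) * sinh_pow t (Suc j)" .
  show "arm j (t + 1 / t) = sinh_pow t j / sinh_pow t (Suc j)"
  proof (induction j)
    case (Suc j)
    have "t + 1 / t - sinh_pow t j / sinh_pow t (Suc j) = sinh_pow t (Suc (Suc j)) / sinh_pow t (Suc j)"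
      using rec[of j] pos[of j] by (simp add: field_simps)
    then show ?case using Suc by simp
  qed (simp add: 0)
qed

text \<open>The path 0, ..., n + k with a leaf n + k + 1 attached to vertex n, so the arms at the
  centre n have n, k and 1 vertices.\<close>

definition tripod :: "nat \<Rightarrow> nat \<Rightarrow> nat pair_pre_digraph" where
  "tripod n k = graph_of (n + k + 2) (\<lambda>i j. (j = Suc i \<and> j \<le> n + k) \<or> (i = n \<and> j = n + k + 1))"

lemma simple_graph_tripod: "1 \<le> k \<Longrightarrow> simple_graph (tripod n k)"
  unfolding tripod_def by (rule simple_graph_of) auto

lemma rho_A_tripod:
  assumes n: "1 \<le> n" and k: "1 \<le> k" and \<rho>: "2 < \<rho>" and eq: "\<rho> = 1 / \<rho> + arm n \<rho> + arm k \<rho>"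
  shows "rho_A (tripod n k) = \<rho>"
proof (rule rho_A_eqI[OF simple_graph_tripod[OF k]])
  define t where "t = growth \<rho>"
  have t: "t > 1" "t + 1 / t = \<rho>" using growth[OF \<rho>] by (auto simp: t_def)
  define S where "S = sinh_pow t"
  note S = sinh_pow[OF t(1), folded S_def, unfolded t(2)]
  \<comment> \<open>On either long arm the value is \<open>S\<close> of the distance to the position
    just beyond the leaf, scaled to 1 at the centre. The hypothesis \<open>eq\<close> is then the
    equation at the centre.\<close>
  define y where "y = (\<lambda>i. if i \<le> n then S (Suc i) / S (Suc n)
    else if i \<le> n + k then S (Suc (n + k) - i) / S (Suc k) else 1 / \<rho>)"
  have yn: "y n = 1" using S(2)[of n] by (simp add: y_def)
  \<comment> \<open>Both formulas give 1 at the centre, so the one for the second arm may be used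
    there as well.\<close>
  have y_right: "y i = S (Suc (n + k) - i) / S (Suc k)" if "n \<le> i" "i \<le> n + k" for i
  proof (cases "i = n")
    case True
    have "Suc (n + k) - n = Suc k" by simp
    then show ?thesis unfolding True yn using S(2)[of k] by simp
  next
    case False
    then show ?thesis using that by (simp add: y_def)
  qed
  fix i assume "i \<in> pverts (tripod n k)"
  then have i: "i < n + k + 2" by (simp add: tripod_def pverts_graph_of)
  have S_pos: "0 < S j" if "0 < j" for j using S(2)[of "j - 1"] that by simp
  show "0 < y i" using \<rho> by (auto simp: y_def S_pos)
  have sum: "nbr_sum (tripod n k) y i = (\<Sum>j\<in>A. y j)"
    if "finite A" "\<And>j. j \<in> A \<longleftrightarrow> j < n + k + 2 \<and>
      (((j = Suc i \<and> j \<le> n + k) \<or> (i = n \<and> j = n + k + 1)) \<or>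
       ((i = Suc j \<and> i \<le> n + k) \<or> (j = n \<and> i = n + k + 1)))" for A
    unfolding tripod_def using i that by (intro nbr_sum_graph_of)
  consider "i = 0" | "0 < i" "i < n" | "i = n" | "n < i" "i < n + k" | "i = n + k" "i \<noteq> n" | "i = n + k + 1"
    using i by linarith
  then show "nbr_sum (tripod n k) y i = \<rho> * y i"
  proof cases
    case 1
    have "nbr_sum (tripod n k) y i = (\<Sum>j\<in>{1}. y j)" using 1 n by (intro sum) auto
    also have "\<dots> = S 2 / S (Suc n)" using n by (simp add: y_def numeral_2_eq_2)
    also have "S 2 = \<rho> * S 1" using S(1) S(3)[of 0] by (simp add: numeral_2_eq_2)
    finally show ?thesis using 1 by (simp add: y_def)
  next
    case 2
    have "i - 1 \<le> n" using 2 by simp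
    then have "y (i - 1) = S i / S (Suc n)" using 2 by (simp add: y_def)
    moreover have "nbr_sum (tripod n k) y i = (\<Sum>j\<in>{i - 1, Suc i}. y j)" using 2 by (intro sum) auto
    ultimately have "nbr_sum (tripod n k) y i = S i / S (Suc n) + y (Suc i)" by simp
    also have "\<dots> = (S i + S (Suc (Suc i))) / S (Suc n)" using 2 by (simp add: y_def add_divide_distrib)
    also have "\<dots> = \<rho> * y i" using 2 S(3)[of i] by (simp add: y_def)
    finally show ?thesis .
  next
    case 3
    have "nbr_sum (tripod n k) y i = (\<Sum>j\<in>{n - 1, Suc n, n + k + 1}. y j)"
      using 3 n k by (intro sum) auto
    also have "\<dots> = y (n - 1) + y (Suc n) + y (n + k + 1)"
    proof -
      have "n - 1 \<noteq> Suc n" "n - 1 \<noteq> n + k + 1" "Suc n \<noteq> n + k + 1" using k by linarith+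
      then show ?thesis by simp
    qed
    also have "y (n - 1) = arm n \<rho>" using n S(4)[of n] by (simp add: y_def)
    also have "y (Suc n) = arm k \<rho>" using k S(4)[of k] y_right[of "Suc n"] by simp
    also have "y (n + k + 1) = 1 / \<rho>" by (simp add: y_def)
    also have "arm n \<rho> + arm k \<rho> + 1 / \<rho> = \<rho> * y i" using eq 3 yn by simp
    finally show ?thesis .
  next
    case 4
    define m where "m = n + k - i"
    have m: "Suc (n + k) - (i - 1) = Suc (Suc m)" "Suc (n + k) - i = Suc m" "Suc (n + k) - Suc i = m"
      using 4 by (auto simp: m_def)
    have "nbr_sum (tripod n k) y i = (\<Sum>j\<in>{i - 1, Suc i}. y j)" using 4 by (intro sum) auto
    also have "\<dots> = y (i - 1) + y (Suc i)" using 4 by simp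
    also have "\<dots> = (S m + S (Suc (Suc m))) / S (Suc k)"
      using 4 y_right[of "i - 1"] y_right[of "Suc i"] unfolding m by (simp add: add_divide_distrib)
    also have "\<dots> = \<rho> * y i" using 4 y_right[of i] unfolding m S(3) by simp
    finally show ?thesis .
  next
    case 5
    have m: "Suc (n + k) - (i - 1) = 2" "Suc (n + k) - i = 1" using 5 k by auto
    have "nbr_sum (tripod n k) y i = (\<Sum>j\<in>{i - 1}. y j)" using 5 k by (intro sum) auto
    also have "\<dots> = S 2 / S (Suc k)" using 5 k y_right[of "i - 1"] unfolding m by simp
    also have "S 2 = \<rho> * S 1" using S(1) S(3)[of 0] by (simp add: numeral_2_eq_2)
    also have "\<rho> * S 1 / S (Suc k) = \<rho> * y i" using 5 y_right[of i] unfolding m by simp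
    finally show ?thesis .
  next
    case 6
    have "nbr_sum (tripod n k) y i = (\<Sum>j\<in>{n}. y j)" using 6 k by (intro sum) auto
    then show ?thesis using 6 yn \<rho> by (simp add: y_def)
  qed
qed

section \<open>Stars whose radii converge to \<open>zeta n\<close>\<close>

lemma margin_strict_mono:
  assumes "2 < \<rho>" "\<rho> < \<rho>'"
  shows "margin n \<rho> < margin n \<rho>'"
proof -
  have "growth \<rho> \<le> growth \<rho>'" using assms by (intro growth_mono) auto
  then have "1 / growth \<rho>' \<le> 1 / growth \<rho>" using growth[of \<rho>] assms by (intro frac_le) auto
  then show ?thesis using branch_strict_mono[OF assms, of n] margin_branch[of n \<rho>] margin_branch[of n \<rho>']
    by linarith
qed

text \<open>Converse of \<open>zeta_eqI\<close>: for t = 1 / sqrt (\<open>delta n\<close>) the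
  argument 1 / t^2 is the root \<open>delta n\<close>.\<close>

lemma margin_zeta:
  assumes "n \<ge> 1" "2 < zeta n"
  shows "margin n (zeta n) = 0"
proof -
  note d = delta_root[OF assms(1)]
  have "delta n \<noteq> 1"
  proof
    assume "delta n = 1"
    then have "zeta n = 2" using zeta_eq[OF assms(1)] by simp
    then show False using assms(2) by simp
  qed
  then have d1: "delta n < 1" using d by simp
  define t where "t = 1 / sqrt (delta n)"
  have t: "t > 1" using d d1 by (simp add: t_def)
  have z: "zeta n = t + 1 / t" using zeta_eq[OF assms(1)] by (simp add: t_def)
  have "1 / t\<^sup>2 = delta n" using d by (simp add: t_def power_divide)
  then show ?thesis using margin_Phi[OF t, of n] d unfolding z by auto
qed

text \<open>By \<open>rho_A_tripod\<close> a zero of \<open>f k\<close> above 2 is the radius of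
  \<open>tripod n k\<close>. At \<open>zeta n\<close> the margin is 0 and arms stay below 1 / t, so
  \<open>f k\<close> is nonnegative there; at a fixed a below \<open>zeta n\<close> the margin is
  negative and the arm ratio approaches 1 / t, so \<open>f k a\<close> < 0 for large k. The radius
  is trapped in between.\<close>

lemma limit_point_zeta_gt_2:
  assumes n: "n \<ge> 1" and z: "2 < zeta n"
  shows "limit_point_rho_A (zeta n)"
proof -
  define P where "P = (\<lambda>\<rho> k. \<rho> = 1 / \<rho> + arm n \<rho> + arm k \<rho>)"
  define f where "f = (\<lambda>k \<rho>. branch n \<rho> - arm k \<rho>)"
  have near: "\<forall>\<^sub>F k in sequentially. a < rho_A (tripod n k) \<and> rho_A (tripod n k) \<le> zeta n \<and>
      P (rho_A (tripod n k)) k" if a: "2 < a" "a < zeta n" for a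
  proof -
    note g = growth[OF a(1)]
    have neg: "margin n a < 0" using margin_strict_mono[OF a, of n] margin_zeta[OF n z] by simp
    have "(\<lambda>k. (1 / growth a) ^ k) \<longlonglongrightarrow> 0" using g by (intro LIMSEQ_realpow_zero) auto
    then have "\<forall>\<^sub>F k in sequentially. (1 / growth a) ^ k < - margin n a"
      by (rule order_tendstoD(2)) (use neg in simp)
    then show ?thesis using eventually_ge_at_top[of 1]
    proof eventually_elim
      case (elim k)
      have fa: "f k a < 0"
        using elim(1) arm_gap[OF a(1), of k] margin_branch[of n a] by (simp add: f_def power_one_over)
      have fz: "0 \<le> f k (zeta n)"
        using arm_less_inverse_growth[OF z, of k] margin_branch[of n "zeta n"] margin_zeta[OF n z]
        by (simp add: f_def)
      have cont: "isCont (f k) x" if "a \<le> x" for x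
      proof -
        have "(f k \<longlongrightarrow> f k x) (at x)"
          unfolding f_def branch_def using that a by (intro tendsto_intros tendsto_arm) auto
        then show ?thesis by (simp add: isCont_def)
      qed
      have "\<exists>x\<ge>a. x \<le> zeta n \<and> f k x = 0"
        using fa fz a cont by (intro IVT) auto
      then obtain x where x: "a \<le> x" "x \<le> zeta n" "f k x = 0" by blast
      have "x \<noteq> a" using x(3) fa by auto
      then have "a < x" using x(1) by simp
      have Px: "P x k" using x(3) by (simp add: P_def f_def branch_def)
      have "rho_A (tripod n k) = x"
        using n elim(2) a x(1) Px by (intro rho_A_tripod) (auto simp: P_def)
      then show ?case using x \<open>a < x\<close> Px by simp
    qed
  qed
  define a where "a = (2 + zeta n) / 2"
  have a: "2 < a" "a < zeta n" using z by (auto simp: a_def)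
  obtain k0 where k0: "\<And>k. k \<ge> k0 \<Longrightarrow> a < rho_A (tripod n k) \<and> P (rho_A (tripod n k)) k"
    using near[OF a] by (auto simp: eventually_sequentially)
  \<comment> \<open>The shift by 1 ensures an arm of at least one vertex, as
    \<open>simple_graph_tripod\<close> requires.\<close>
  define G where "G = (\<lambda>k. tripod n (k + k0 + 1))"
  have "simple_graph (G k)" for k unfolding G_def by (rule simple_graph_tripod) simp
  moreover have "rho_A (G i) \<noteq> rho_A (G j)" if "i \<noteq> j" for i j
  proof
    assume eq: "rho_A (G i) = rho_A (G j)"
    define \<rho> where "\<rho> = rho_A (G i)"
    have \<rho>: "2 < \<rho>" "P \<rho> (i + k0 + 1)" "P \<rho> (j + k0 + 1)"
      using k0[of "i + k0 + 1"] k0[of "j + k0 + 1"] a eq by (auto simp: \<rho>_def G_def)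
    \<comment> \<open>At fixed \<rho> the arm ratio determines the length of the arm, so equal radii
      force equal indices.\<close>
    have "strict_mono (\<lambda>k. arm k \<rho>)" using arm_less_Suc[OF \<rho>(1)] unfolding strict_mono_Suc_iff by blast
    moreover have "arm (i + k0 + 1) \<rho> = arm (j + k0 + 1) \<rho>"
      using \<rho>(2,3) unfolding P_def by linarith
    ultimately have "i + k0 + 1 = j + k0 + 1" by (rule strict_mono_eq[THEN iffD1])
    then show False using that by simp
  qed
  moreover have "(\<lambda>k. rho_A (G k)) \<longlonglongrightarrow> zeta n"
  proof -
    have "(\<lambda>k. rho_A (tripod n k)) \<longlonglongrightarrow> zeta n"
    proof (rule order_tendstoI)
      fix b assume "b < zeta n"
      \<comment> \<open>The maximum with a keeps the lower bound above 2, as \<open>near\<close>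
        requires.\<close>
      then have "2 < max a b" "max a b < zeta n" using a by auto
      from near[OF this] show "\<forall>\<^sub>F k in sequentially. b < rho_A (tripod n k)"
        by eventually_elim simp
    next
      fix b assume b: "zeta n < b"
      from near[OF a] show "\<forall>\<^sub>F k in sequentially. rho_A (tripod n k) < b"
        by eventually_elim (use b in simp)
    qed
    from LIMSEQ_ignore_initial_segment[OF this, of "k0 + 1"] show ?thesis by (simp add: G_def add.assoc)
  qed
  ultimately show ?thesis unfolding limit_point_rho_A_def by blast
qed

lemma zeta_ge_2: "n \<ge> 1 \<Longrightarrow> 2 \<le> zeta n"
proof (induction n rule: dec_induct)
  case base
  then show ?case using zeta_1 by simp
next
  case (step n)
  then show ?case using zeta_strict_increasing[of n] by simp
qed

text \<open>The value 2 comes from paths, every larger one from tripods.\<close>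

lemma limit_point_zeta: "n \<ge> 1 \<Longrightarrow> limit_point_rho_A (zeta n)"
  using zeta_ge_2[of n] limit_point_zeta_gt_2[of n] limit_point_2 by (cases "zeta n = 2") auto

theorem theorem2p3:
  shows "(\<forall>n\<ge>1. \<exists>!x::real. 0 < x \<and> poly (Phi n) x = 0)
    \<and> zeta 1 = 2
    \<and> (\<forall>n\<ge>1. zeta n < zeta (n + 1))
    \<and> zeta \<longlonglongrightarrow> sqrt (2 + sqrt 5)
    \<and> {\<gamma>. limit_point_rho_A \<gamma> \<and> \<gamma> < sqrt (2 + sqrt 5)} = {zeta n | n. n \<ge> 1}"
proof (intro conjI)
  show "\<forall>n\<ge>1. \<exists>!x::real. 0 < x \<and> poly (Phi n) x = 0" using Phi_root_ex1 by blast
  show "zeta 1 = 2" by (rule zeta_1)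
  show "\<forall>n\<ge>1. zeta n < zeta (n + 1)" using zeta_strict_increasing by blast
  show "zeta \<longlonglongrightarrow> sqrt (2 + sqrt 5)" by (rule zeta_tendsto)
  show "{\<gamma>. limit_point_rho_A \<gamma> \<and> \<gamma> < sqrt (2 + sqrt 5)} = {zeta n | n. n \<ge> 1}"
    using limit_point_is_zeta limit_point_zeta zeta_less by blast
qed

end
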